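(* Let $c_0>0$ and, in the model with $m_0$ true structural breaks described in the context, let Assumption A (on the processes) and Assumption C (on break magnitudes and spacing) hold. If $\lambda_T = 2 d c_0 (\log T/T)^{1/4}$, then there exists some $C>0$ (not depending on $T$) such that, with probability greater than $1-\frac{C}{c_0^4\log T}$, $$\frac1T\left\Vert \boldsymbol Z\left(\hat{\boldsymbol\theta}(T)-\boldsymbol\theta^0(T)\right)\right\Vert^2 \le 4 d c_0\left(\frac{\log T}{T}\right)^{1/4}(m_0+1)\,M_\theta .$$
   Context: Norms: $\Vert\cdot\Vert$ is the Euclidean norm for vectors and the Frobenius norm for matrices. Processes. $q,r,s$ are fixed positive integers. $Y_t\in\mathbb R^q$ is the response, $X_t\in\mathbb R^r$ satisfies $X_t=X_{t-1}+\xi_t$, $w_t\in\mathbb R^s$ is a stationary regressor, $u_t\in\mathbb R^q$ is the error. $Z_t=(T^{-1/2}X_t',\,T^{-1}t,\,1,\,w_t')'\in\mathbb R^{r+2+s}$, $d=q(r+2+s)$, $\bar Z_t=Z_t'\otimes I_q\in\mathbb R^{q\times d}$. (So $\bar Z_t\theta=[A,\delta,\mu,B]Z_t$ when $\theta$ stacks the columns of $[A,\delta,\mu,B]$.) $\boldsymbol K$ is the fixed $d\times d$ permutation (commutation) matrix that reorders such a vector $\theta$ equation by equation, $\boldsymbol\theta=\boldsymbol K\theta$, so $\theta=\boldsymbol K'\boldsymbol\theta$. Model. For each $T$ there are true vectors $\boldsymbol\theta^0_1,\dots,\boldsymbol\theta^0_T\in\mathbb R^d$, $\boldsymbol\theta^0(T)=(\boldsymbol\theta_1^{0\prime},\dots,\boldsymbol\theta_T^{0\prime})'$,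 with $$Y_t=\bar Z_t\sum_{i=1}^t\boldsymbol K'\boldsymbol\theta^0_i+u_t,\qquad t=1,\dots,T.$$ $\boldsymbol\theta^0_1\ne\boldsymbol 0$ is the baseline coefficient and $\boldsymbol\theta^0_i$, $i\ge2$, is the coefficient change at time $i$. Exactly $m_0$ (a fixed number) of the changes are nonzero, at the true breakpoints $t^0_1<\dots<t^0_{m_0}$; set $t^0_0=1$, $t^0_{m_0+1}=T+1$. Stacked form: $\boldsymbol Y=\boldsymbol Z\boldsymbol\theta(T)+\boldsymbol U$, where $\boldsymbol Y,\boldsymbol U\in\mathbb R^{Tq}$ stack the $Y_t$, $u_t$ over all $t$ and equations, and $\boldsymbol Z\in\mathbb R^{Tq\times Td}$ is the matrix such that, for every $\boldsymbol\theta(T)=(\boldsymbol\theta_1',\dots,\boldsymbol\theta_T')'$ with $\boldsymbol\theta_i\in\mathbb R^d$, the entries of $\boldsymbol Z\boldsymbol\theta(T)$ corresponding to time $t$ are $\bar Z_t\sum_{i=1}^t\boldsymbol K'\boldsymbol\theta_i$ (so $\Vert\boldsymbol Z\boldsymbol\theta(T)\Vert^2=\sum_{t=1}^T\Vert\bar Z_t\sum_{i\le t}\boldsymbol K'\boldsymbol\theta_i\Vert^2$). Group LASSO estimator: $\hat{\boldsymbol\theta}(T)=(\hat{\boldsymbol\theta}_1',\dots,\hat{\boldsymbol\theta}_T')'$ is a minimizer over $\boldsymbol\theta(T)\in\mathbb R^{Td}$ of $$\frac1T\Vert\boldsymbol Y-\boldsymbol Z\boldsymbol\theta(T)\Vert^2+\lambda_T\sum_{i=1}^T\Vert\boldsymbol\theta_i\Vert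 ,$$ where $\lambda_T>0$ is a tuning parameter. Assumption A. (i) $u_t=\sum_{j\ge0}C_j\epsilon_{t-j}=C(L)\epsilon_t$ and $\xi_t=\sum_{j\ge0}D_je_{t-j}=D(L)e_t$ with $C(1)$, $D(1)$ of full rank, $\sum_j j\Vert C_j\Vert<\infty$, $\sum_j j\Vert D_j\Vert<\infty$; $(\epsilon_t,e_t)$ are i.i.d., mean zero, with finite $4+a$ moment for some $a>0$. $w_t$ is a mean-zero second-order stationary process with uniformly bounded $4+\delta$ moment ($\delta>0$). The long-run covariance matrix $\Omega_\xi=\sum_{j=-\infty}^\infty E\xi_t\xi_{t-j}'$ is positive definite. (ii) For some $\epsilon>0$, every component $u_{j,i}$ ($1\le j\le q$) of $u_i$, and uniformly over $T$ and $1\le t\le T$: $\sup E\left|\frac1T\sum_{i=1}^tX_{l,i}u_{j,i}\right|^{4+\epsilon}<\infty$ for $1\le l\le r$, and $\sup E\left|\frac1{\sqrt T}\sum_{i=1}^tw_{l,i}u_{j,i}\right|^{4+\epsilon}<\infty$ for $1\le l\le s$. Assumption C. (i) $m_\theta=\min_{1\le j\le m_0+1}\Vert\boldsymbol\theta^0_{t^0_{j-1}}\Vert\ge\nu>0$ and $M_\theta=\max_{1\le j\le m_0+1}\Vert\boldsymbol\theta^0_{t^0_{j-1}}\Vert\le\mathcal V<\infty$, with constants $\nu,\mathcal V$. (ii) $\min_{1\le j\le m_0+1}|t^0_j-t^0_{j-1}|/(T\gamma_T)\to\infty$ for some $\gamma_T\to0$ with $\gamma_T/\lambda_T\to\infty$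 as $T\to\infty$. *)

theory Defs
  imports "HOL-Probability.Probability"
begin

text \<open>Dimensions are index types: \<open>q = CARD('q)\<close>, \<open>r = CARD('r)\<close>, \<open>s = CARD('s)\<close>. The
  coordinates of \<open>Z\<^sub>t = (T\<^sup>-\<^sup>1\<^sup>/\<^sup>2 X\<^sub>t', t/T, 1, w\<^sub>t')'\<close> are indexed by a sum type of cardinality
  \<open>r + 2 + s\<close>. A coefficient vector of dimension \<open>d = q(r + 2 + s)\<close> is indexed by
  (regressor, equation) when it stacks the columns of \<open>[A, \<delta>, \<mu>, B]\<close>, and by
  (equation, regressor) when it is ordered equation by equation.\<close>

type_synonym ('r, 's) regressor = "'r + 2 + 's"
type_synonym ('q, 'r, 's) coeff_cols = "real ^ (('r, 's) regressor \<times> 'q)"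
type_synonym ('q, 'r, 's) coeff = "real ^ ('q \<times> ('r, 's) regressor)"

definition regressor_vec ::
  "nat \<Rightarrow> nat \<Rightarrow> real ^ 'r \<Rightarrow> real ^ 's \<Rightarrow> real ^ ('r::finite, 's::finite) regressor" where
  "regressor_vec T t x w = (\<chi> k. case k of
       Inl l \<Rightarrow> real T powr (- 1/2) * x $ l
     | Inr (Inl b) \<Rightarrow> (if b = 1 then real t / real T else 1)
     | Inr (Inr l) \<Rightarrow> w $ l)"

text \<open>The Kronecker product \<open>z' \<otimes> B\<close> of a row vector and a matrix; the one-element row index
  of \<open>z'\<close> is dropped.\<close>

definition row_kronecker :: "real ^ 'k \<Rightarrow> real ^ 'n ^ 'm \<Rightarrow> real ^ ('k::finite \<times> 'n::finite) ^ 'm" where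
  "row_kronecker z B = (\<chi> i p. z $ fst p * B $ i $ snd p)"

definition Zbar ::
  "nat \<Rightarrow> nat \<Rightarrow> real ^ 'r \<Rightarrow> real ^ 's \<Rightarrow> real ^ (('r::finite, 's::finite) regressor \<times> 'q::finite) ^ 'q" where
  "Zbar T t x w = row_kronecker (regressor_vec T t x w) (mat 1)"

text \<open>The permutation matrix \<open>K\<close> taking the column-stacked vector to the equation-wise one.\<close>

definition commutation_matrix :: "real ^ ('k::finite \<times> 'q::finite) ^ ('q \<times> 'k)" where
  "commutation_matrix = (\<chi> a b. if a = prod.swap b then 1 else 0)"

text \<open>As \<open>T\<close> varies, stacked vectors are functions of the block index, of which only the
  blocks \<open>1, \<dots>, T\<close> are used. The stacked design matrix is the linear map sending
  \<open>(\<theta>\<^sub>1, \<dots>, \<theta>\<^sub>T)\<close> to the vector whose block \<open>t\<close> is given below; \<open>x\<close> and \<open>w\<close> are the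
  observed paths of the regressors.\<close>

definition design_apply ::
  "nat \<Rightarrow> (nat \<Rightarrow> real ^ 'r) \<Rightarrow> (nat \<Rightarrow> real ^ 's) \<Rightarrow>
   (nat \<Rightarrow> ('q::finite, 'r::finite, 's::finite) coeff) \<Rightarrow> nat \<Rightarrow> real ^ 'q" where
  "design_apply T x w \<theta> t =
     Zbar T t (x t) (w t) *v (\<Sum>i=1..t. transpose commutation_matrix *v \<theta> i)"

definition stacked_norm :: "nat \<Rightarrow> (nat \<Rightarrow> 'v::real_normed_vector) \<Rightarrow> real" where
  "stacked_norm T v = L2_set (\<lambda>t. norm (v t)) {1..T}"

definition group_lasso_objective ::
  "nat \<Rightarrow> real \<Rightarrow> (nat \<Rightarrow> real ^ 'r) \<Rightarrow> (nat \<Rightarrow> real ^ 's) \<Rightarrow> (nat \<Rightarrow> real ^ 'q) \<Rightarrow>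
   (nat \<Rightarrow> ('q::finite, 'r::finite, 's::finite) coeff) \<Rightarrow> real" where
  "group_lasso_objective T lam x w y \<theta> =
     1 / real T * (stacked_norm T (\<lambda>t. y t - design_apply T x w \<theta> t))\<^sup>2
       + lam * (\<Sum>i=1..T. norm (\<theta> i))"

definition is_group_lasso ::
  "nat \<Rightarrow> real \<Rightarrow> (nat \<Rightarrow> real ^ 'r) \<Rightarrow> (nat \<Rightarrow> real ^ 's) \<Rightarrow> (nat \<Rightarrow> real ^ 'q) \<Rightarrow>
   (nat \<Rightarrow> ('q::finite, 'r::finite, 's::finite) coeff) \<Rightarrow> bool" where
  "is_group_lasso T lam x w y \<theta> \<longleftrightarrow>
     (\<forall>\<theta>'. group_lasso_objective T lam x w y \<theta> \<le> group_lasso_objective T lam x w y \<theta>')"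

text \<open>\<open>\<theta>\<close> has a nonzero baseline and exactly \<open>m0\<close> nonzero changes, at the times \<open>bp 1 < \<dots> < bp m0\<close>.
  This is possible only for \<open>m0 < T\<close>.\<close>

definition has_breaks :: "nat \<Rightarrow> nat \<Rightarrow> (nat \<Rightarrow> nat) \<Rightarrow> (nat \<Rightarrow> 'v::real_normed_vector) \<Rightarrow> bool" where
  "has_breaks T m0 bp \<theta> \<longleftrightarrow>
     \<theta> 1 \<noteq> 0 \<and> bp 0 = 1 \<and> bp (m0 + 1) = T + 1 \<and>
     strict_mono_on {1..m0} bp \<and> {i \<in> {2..T}. \<theta> i \<noteq> 0} = bp ` {1..m0}"

definition min_magnitude :: "nat \<Rightarrow> (nat \<Rightarrow> nat) \<Rightarrow> (nat \<Rightarrow> 'v::real_normed_vector) \<Rightarrow> real" where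
  "min_magnitude m0 bp \<theta> = Min ((\<lambda>j. norm (\<theta> (bp (j - 1)))) ` {1..m0 + 1})"

definition max_magnitude :: "nat \<Rightarrow> (nat \<Rightarrow> nat) \<Rightarrow> (nat \<Rightarrow> 'v::real_normed_vector) \<Rightarrow> real" where
  "max_magnitude m0 bp \<theta> = Max ((\<lambda>j. norm (\<theta> (bp (j - 1)))) ` {1..m0 + 1})"

definition min_spacing :: "nat \<Rightarrow> (nat \<Rightarrow> nat) \<Rightarrow> real" where
  "min_spacing m0 bp = Min ((\<lambda>j. \<bar>real (bp j) - real (bp (j - 1))\<bar>) ` {1..m0 + 1})"

definition cross_moment ::
  "'a measure \<Rightarrow> ('a \<Rightarrow> real ^ 'm) \<Rightarrow> ('a \<Rightarrow> real ^ 'n) \<Rightarrow> real ^ 'n ^ 'm" where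
  "cross_moment M x y = (\<chi> i j. \<integral>\<omega>. x \<omega> $ i * y \<omega> $ j \<partial>M)"

text \<open>The autocovariances of a stationary process do not depend on the base time, taken to be \<open>0\<close>.\<close>

definition long_run_cov :: "'a measure \<Rightarrow> (int \<Rightarrow> 'a \<Rightarrow> real ^ 'n) \<Rightarrow> real ^ 'n ^ 'n" where
  "long_run_cov M \<xi> = (\<Sum>\<^sub>\<infinity>j\<in>UNIV. cross_moment M (\<xi> 0) (\<xi> (0 - j)))"

definition positive_definite :: "real ^ 'n ^ 'n \<Rightarrow> bool" where
  "positive_definite A \<longleftrightarrow> transpose A = A \<and> (\<forall>x. x \<noteq> 0 \<longrightarrow> x \<bullet> (A *v x) > 0)"

text \<open>\<open>v\<^sub>t = \<Sum>\<^sub>j C\<^sub>j \<eta>\<^bsub>t-j\<^esub>\<close> with the conditions on the filter \<open>C(L)\<close>. The norm of a matrix of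
  type \<^typ>\<open>real ^ 'm ^ 'n\<close> is the Frobenius norm.\<close>

definition linear_process ::
  "'a measure \<Rightarrow> (nat \<Rightarrow> real ^ 'm ^ 'n) \<Rightarrow> (int \<Rightarrow> 'a \<Rightarrow> real ^ 'm) \<Rightarrow> (int \<Rightarrow> 'a \<Rightarrow> real ^ 'n) \<Rightarrow> bool" where
  "linear_process M C \<eta> v \<longleftrightarrow>
     summable (\<lambda>j. real j * norm (C j)) \<and>
     rank (\<Sum>j. C j) = min CARD('m) CARD('n) \<and>
     (\<forall>t. v t \<in> borel_measurable M) \<and>
     (\<forall>t. AE \<omega> in M. (\<lambda>j. C j *v \<eta> (t - int j) \<omega>) sums v t \<omega>)"

definition iid_innovations ::
  "'a measure \<Rightarrow> (int \<Rightarrow> 'a \<Rightarrow> real ^ 'm) \<Rightarrow> (int \<Rightarrow> 'a \<Rightarrow> real ^ 'n) \<Rightarrow> bool" where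
  "iid_innovations M \<epsilon> e \<longleftrightarrow>
     prob_space.indep_vars M (\<lambda>_. borel) (\<lambda>t \<omega>. (\<epsilon> t \<omega>, e t \<omega>)) UNIV \<and>
     (\<forall>t. distr M borel (\<lambda>\<omega>. (\<epsilon> t \<omega>, e t \<omega>)) = distr M borel (\<lambda>\<omega>. (\<epsilon> 0 \<omega>, e 0 \<omega>))) \<and>
     (\<forall>t. (\<integral>\<omega>. \<epsilon> t \<omega> \<partial>M) = 0 \<and> (\<integral>\<omega>. e t \<omega> \<partial>M) = 0) \<and>
     (\<exists>a>0. \<forall>t. integrable M (\<lambda>\<omega>. norm (\<epsilon> t \<omega>, e t \<omega>) powr (4 + a)))"

definition stationary_regressor :: "'a measure \<Rightarrow> (int \<Rightarrow> 'a \<Rightarrow> real ^ 's) \<Rightarrow> bool" where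
  "stationary_regressor M w \<longleftrightarrow>
     (\<forall>t. w t \<in> borel_measurable M) \<and>
     (\<forall>t. (\<integral>\<omega>. w t \<omega> \<partial>M) = 0) \<and>
     (\<forall>t h. cross_moment M (w t) (w (t - h)) = cross_moment M (w 0) (w (0 - h))) \<and>
     (\<exists>\<delta>>0. (SUP t. \<integral>\<^sup>+\<omega>. ennreal (norm (w t \<omega>) powr (4 + \<delta>)) \<partial>M) < \<infinity>)"

definition assumption_A ::
  "'a measure \<Rightarrow> (nat \<Rightarrow> real ^ 'm ^ 'q) \<Rightarrow> (nat \<Rightarrow> real ^ 'n ^ 'r) \<Rightarrow>
   (int \<Rightarrow> 'a \<Rightarrow> real ^ 'm) \<Rightarrow> (int \<Rightarrow> 'a \<Rightarrow> real ^ 'n) \<Rightarrow>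
   (int \<Rightarrow> 'a \<Rightarrow> real ^ 'q) \<Rightarrow> (int \<Rightarrow> 'a \<Rightarrow> real ^ 'r) \<Rightarrow>
   (nat \<Rightarrow> 'a \<Rightarrow> real ^ 'r) \<Rightarrow> (int \<Rightarrow> 'a \<Rightarrow> real ^ 's) \<Rightarrow> bool" where
  "assumption_A M C D \<epsilon> e u \<xi> X w \<longleftrightarrow>
     iid_innovations M \<epsilon> e \<and> linear_process M C \<epsilon> u \<and> linear_process M D e \<xi> \<and>
     stationary_regressor M w \<and> positive_definite (long_run_cov M \<xi>) \<and>
     (\<exists>\<kappa>>0. \<forall>j.
        (\<forall>l. (SUP T\<in>{1..}. SUP t\<in>{1..T}.
            \<integral>\<^sup>+\<omega>. ennreal (\<bar>1 / real T * (\<Sum>i=1..t. X i \<omega> $ l * u (int i) \<omega> $ j)\<bar> powr (4 + \<kappa>)) \<partial>M) < \<infinity>) \<and>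
        (\<forall>l. (SUP T\<in>{1..}. SUP t\<in>{1..T}.
            \<integral>\<^sup>+\<omega>. ennreal (\<bar>1 / sqrt (real T) * (\<Sum>i=1..t. w (int i) \<omega> $ l * u (int i) \<omega> $ j)\<bar> powr (4 + \<kappa>)) \<partial>M) < \<infinity>))"

text \<open>The bounds on the magnitudes are uniform in \<open>T\<close>.\<close>

definition assumption_C ::
  "nat \<Rightarrow> (nat \<Rightarrow> nat \<Rightarrow> nat) \<Rightarrow> (nat \<Rightarrow> nat \<Rightarrow> 'v::real_normed_vector) \<Rightarrow> (nat \<Rightarrow> real) \<Rightarrow> bool" where
  "assumption_C m0 bp \<theta>0 lam \<longleftrightarrow>
     (\<exists>\<nu>>0. \<exists>V. \<forall>T>m0. min_magnitude m0 (bp T) (\<theta>0 T) \<ge> \<nu> \<and> max_magnitude m0 (bp T) (\<theta>0 T) \<le> V) \<and>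
     (\<exists>\<gamma>. \<gamma> \<longlonglongrightarrow> 0 \<and> filterlim (\<lambda>T. \<gamma> T / lam T) at_top sequentially \<and>
          filterlim (\<lambda>T. min_spacing m0 (bp T) / (real T * \<gamma> T)) at_top sequentially)"

end

theory Submission
  imports Defs
begin

text \<open>Comparing the objective at the estimator and at the truth, the cross term between the errors and
  the fitted difference is, after exchanging the order of summation, at most the largest norm of a
  tail sum \<open>\<Sum>\<^bsub>t\<ge>i\<^esub> Z\<^sub>t \<otimes> u\<^sub>t\<close> times \<open>\<Sum>\<^sub>i \<parallel>\<theta>\<^sub>i - \<theta>\<^sup>0\<^sub>i\<parallel>\<close>. Once \<open>T \<lambda>\<^sub>T\<close> dominates twice that norm, the
  penalty absorbs the cross term and the triangle inequality leaves \<open>2 \<lambda>\<^sub>T \<Sum>\<^sub>i \<parallel>\<theta>\<^sup>0\<^sub>i\<parallel>\<close>. The partial sums of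
  the score coordinates have fourth moments of order \<open>T\<^sup>2\<close>, so the union bound over the \<open>d T\<close> coordinates and
  times, with Markov's inequality at a level of order \<open>T\<^sup>3\<^sup>/\<^sup>4 (log T)\<^sup>1\<^sup>/\<^sup>4\<close>, costs \<open>O(1 / log T)\<close>. For the
  trend and the intercept this rests on the fourth moments of partial sums of a linear process, which
  are bounded by truncating the filter and applying Fatou's lemma.\<close>

section \<open>Elementary inequalities and measurability of vectors\<close>

lemma norm_matrix_vector_le_Frobenius:
  fixes A :: "real ^ 'm::finite ^ 'n::finite"
  shows "norm (A *v x) \<le> norm A * norm x"
proof -
  have "norm (A *v x) \<le> L2_set (\<lambda>i. norm (A $ i) * norm x) UNIV"
    unfolding norm_vec_def[of "A *v x"]
    by (rule L2_set_mono) (auto simp: matrix_vector_mul_component Cauchy_Schwarz_ineq2)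
  also have "\<dots> = norm A * norm x"
    by (simp add: norm_vec_def[of A] L2_set_left_distrib)
  finally show ?thesis .
qed

lemma borel_measurable_vecI:
  fixes f :: "'a \<Rightarrow> real ^ 'n::finite"
  assumes "\<And>i. (\<lambda>\<omega>. f \<omega> $ i) \<in> borel_measurable M"
  shows "f \<in> borel_measurable M"
proof (subst borel_measurable_euclidean_space, intro ballI)
  fix b :: "real ^ 'n" assume "b \<in> Basis"
  then obtain i where "b = axis i 1" by (auto simp: Basis_vec_def)
  then have "(\<lambda>\<omega>. f \<omega> \<bullet> b) = (\<lambda>\<omega>. f \<omega> $ i)" by (simp add: inner_axis)
  then show "(\<lambda>\<omega>. f \<omega> \<bullet> b) \<in> borel_measurable M" using assms[of i] by (simp only:)
qed

lemma borel_measurable_matrix_vector_mult: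
  fixes A :: "'a \<Rightarrow> real ^ 'm::finite ^ 'n::finite"
  assumes A: "\<And>i j. (\<lambda>\<omega>. A \<omega> $ i $ j) \<in> borel_measurable M"
    and f: "f \<in> borel_measurable M"
  shows "(\<lambda>\<omega>. A \<omega> *v f \<omega>) \<in> borel_measurable M"
proof (rule borel_measurable_vecI)
  show "(\<lambda>\<omega>. (A \<omega> *v f \<omega>) $ i) \<in> borel_measurable M" for i
    unfolding matrix_vector_mult_def vec_lambda_beta
    by (intro borel_measurable_sum borel_measurable_times A measurable_compose[OF f] borel_measurable_nth)
qed

text \<open>The Cauchy-Schwarz inequality with weights \<open>a\<close>, applied twice; for weights
  of total 1 this is Jensen's inequality for the fourth power. It serves with unit weights for the
  coordinates of a vector and with the weights \<open>norm (C j)\<close> for a filter.\<close>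

lemma sum_fourth_power_le:
  fixes a y :: "'i \<Rightarrow> real"
  assumes "\<And>i. i \<in> I \<Longrightarrow> 0 \<le> a i"
  shows "(\<Sum>i\<in>I. a i * y i) ^ 4 \<le> (\<Sum>i\<in>I. a i) ^ 3 * (\<Sum>i\<in>I. a i * y i ^ 4)"
proof -
  have CS: "(\<Sum>i\<in>I. a i * z i)\<^sup>2 \<le> (\<Sum>i\<in>I. a i) * (\<Sum>i\<in>I. a i * (z i)\<^sup>2)" for z
  proof -
    have "(\<Sum>i\<in>I. a i * z i)\<^sup>2 = (\<Sum>i\<in>I. sqrt (a i) * (sqrt (a i) * z i))\<^sup>2"
      using assms by (intro arg_cong[of _ _ "\<lambda>x. x\<^sup>2"] sum.cong) (auto simp: mult.assoc[symmetric])
    also have "\<dots> \<le> (\<Sum>i\<in>I. (sqrt (a i))\<^sup>2) * (\<Sum>i\<in>I. (sqrt (a i) * z i)\<^sup>2)"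
      by (rule Cauchy_Schwarz_ineq_sum)
    also have "\<dots> = (\<Sum>i\<in>I. a i) * (\<Sum>i\<in>I. a i * (z i)\<^sup>2)"
      using assms by (simp add: power_mult_distrib)
    finally show ?thesis .
  qed
  let ?A = "\<Sum>i\<in>I. a i"
  have A: "0 \<le> ?A" using assms by (rule sum_nonneg)
  have "(\<Sum>i\<in>I. a i * y i) ^ 4 = ((\<Sum>i\<in>I. a i * y i)\<^sup>2)\<^sup>2" by simp
  also have "\<dots> \<le> (?A * (\<Sum>i\<in>I. a i * (y i)\<^sup>2))\<^sup>2"
    by (intro power_mono CS) simp
  also have "\<dots> = ?A\<^sup>2 * (\<Sum>i\<in>I. a i * (y i)\<^sup>2)\<^sup>2" by (rule power_mult_distrib)
  also have "\<dots> \<le> ?A\<^sup>2 * (?A * (\<Sum>i\<in>I. a i * ((y i)\<^sup>2)\<^sup>2))"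
    by (intro mult_left_mono CS) simp
  also have "\<dots> = ?A ^ 3 * (\<Sum>i\<in>I. a i * y i ^ 4)" by (simp add: power2_eq_square power3_eq_cube power4_eq_xxxx mult.assoc)
  finally show ?thesis .
qed

lemma norm_fourth_power_le_sum:
  fixes x :: "real ^ 'n::finite"
  shows "norm x ^ 4 \<le> real CARD('n) ^ 3 * (\<Sum>l\<in>UNIV. (x $ l) ^ 4)"
proof -
  have "norm x ^ 4 \<le> (\<Sum>l\<in>UNIV. 1 * \<bar>x $ l\<bar>) ^ 4"
    using norm_le_l1_cart[of x] by (intro power_mono) auto
  also have "\<dots> \<le> (\<Sum>l\<in>(UNIV::'n set). 1) ^ 3 * (\<Sum>l\<in>UNIV. 1 * \<bar>x $ l\<bar> ^ 4)"
    by (rule sum_fourth_power_le) simp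
  finally show ?thesis by simp
qed

text \<open>Trades a moment of order \<open>4 + a\<close>, the form in which the assumptions are
  stated, for a fourth moment; the summand 1 covers \<open>\<bar>x\<bar> \<le> 1\<close>.\<close>

lemma power4_le_powr: "\<bar>x::real\<bar> ^ 4 \<le> 1 + \<bar>x\<bar> powr (4 + a)" if "0 < a"
proof (cases "\<bar>x\<bar> \<le> 1")
  case True
  then show ?thesis by (intro add_increasing2 power_le_one) auto
next
  case False
  then have "\<bar>x\<bar> ^ 4 = \<bar>x\<bar> powr 4" by (simp add: powr_numeral[symmetric] del: powr_numeral)
  also have "\<dots> \<le> \<bar>x\<bar> powr (4 + a)" using False that by (intro powr_mono) auto
  finally show ?thesis by simp
qed

section \<open>Fourth moments of sums of independent variables\<close>

context prob_space
begin

text \<open>Constants are integrable on a probability space, so \<open>1 + S \<omega> ^ 4\<close> is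
  an integrable majorant of every lower power.\<close>

lemma integrable_power_le4:
  fixes S :: "'a \<Rightarrow> real"
  assumes [measurable]: "S \<in> borel_measurable M" and S: "integrable M (\<lambda>\<omega>. S \<omega> ^ 4)" and k: "k \<le> 4"
  shows "integrable M (\<lambda>\<omega>. S \<omega> ^ k)"
proof (rule Bochner_Integration.integrable_bound[of M "\<lambda>\<omega>. 1 + S \<omega> ^ 4"])
  show "AE \<omega> in M. norm (S \<omega> ^ k) \<le> norm (1 + S \<omega> ^ 4)"
  proof (rule AE_I2)
    fix \<omega>
    have "\<bar>S \<omega>\<bar> ^ k \<le> 1 + \<bar>S \<omega>\<bar> ^ 4"
    proof (cases "\<bar>S \<omega>\<bar> \<le> 1")
      case True
      then show ?thesis by (intro add_increasing2 power_le_one) auto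
    next
      case False
      then have "\<bar>S \<omega>\<bar> ^ k \<le> \<bar>S \<omega>\<bar> ^ 4" using k by (intro power_increasing) auto
      then show ?thesis by simp
    qed
    then show "norm (S \<omega> ^ k) \<le> norm (1 + S \<omega> ^ 4)" by (simp add: power_abs)
  qed
qed (use S in auto)

text \<open>This is the nonnegativity of the variance of the square of \<open>S\<close>.\<close>

lemma second_moment_le_sqrt_fourth:
  fixes S :: "'a \<Rightarrow> real"
  assumes [measurable]: "S \<in> borel_measurable M" and S: "integrable M (\<lambda>\<omega>. S \<omega> ^ 4)"
  shows "expectation (\<lambda>\<omega>. (S \<omega>)\<^sup>2) \<le> sqrt (expectation (\<lambda>\<omega>. S \<omega> ^ 4))"
proof (rule real_le_rsqrt)
  have "0 \<le> variance (\<lambda>\<omega>. (S \<omega>)\<^sup>2)" by (rule variance_positive)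
  also have "\<dots> = expectation (\<lambda>\<omega>. S \<omega> ^ 4) - (expectation (\<lambda>\<omega>. (S \<omega>)\<^sup>2))\<^sup>2"
    using S by (subst variance_eq) (simp_all add: integrable_power_le4)
  finally show "(expectation (\<lambda>\<omega>. (S \<omega>)\<^sup>2))\<^sup>2 \<le> expectation (\<lambda>\<omega>. S \<omega> ^ 4)" by simp
qed

text \<open>Induction on \<open>I\<close>. In the fourth power of \<open>x i + S\<close>
  independence factors every mixed moment, and the terms in which \<open>x i\<close> or
  \<open>S\<close> has exponent 1 vanish because the means are zero. The surviving middle term needs
  the second moment of \<open>S\<close>, so the four claims are carried along together.\<close>

lemma indep_sum_moments:
  fixes x :: "'i \<Rightarrow> 'a \<Rightarrow> real"
  assumes "finite I" and "indep_vars (\<lambda>_. borel) x I"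
    and "\<And>i. i \<in> I \<Longrightarrow> integrable M (\<lambda>\<omega>. x i \<omega> ^ 4)"
    and "\<And>i. i \<in> I \<Longrightarrow> expectation (x i) = 0"
    and "\<And>i. i \<in> I \<Longrightarrow> expectation (\<lambda>\<omega>. x i \<omega> ^ 4) \<le> \<mu>"
    and "0 \<le> \<mu>"
  shows "integrable M (\<lambda>\<omega>. (\<Sum>i\<in>I. x i \<omega>) ^ 4)"
    and "expectation (\<lambda>\<omega>. \<Sum>i\<in>I. x i \<omega>) = 0"
    and "expectation (\<lambda>\<omega>. (\<Sum>i\<in>I. x i \<omega>)\<^sup>2) \<le> card I * sqrt \<mu>"
    and "expectation (\<lambda>\<omega>. (\<Sum>i\<in>I. x i \<omega>) ^ 4) \<le> 3 * (real (card I))\<^sup>2 * \<mu>"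
  using assms(1-5)
proof (induction I rule: finite_induct)
  case empty
  {
    case 1 show ?case by simp
  next
    case 2 show ?case by simp
  next
    case 3 show ?case by simp
  next
    case 4 show ?case by simp
  }
next
  case (insert i I)
  let ?S = "\<lambda>\<omega>. \<Sum>i\<in>I. x i \<omega>"
  \<comment> \<open>The induction leaves one goal per claim, each with the hypotheses for
    \<open>insert i I\<close> as premises. All four are proved at once under these premises and then
    distributed to the goals.\<close>
  have main: "integrable M (\<lambda>\<omega>. (\<Sum>i\<in>insert i I. x i \<omega>) ^ 4) \<and>
    expectation (\<lambda>\<omega>. \<Sum>i\<in>insert i I. x i \<omega>) = 0 \<and>
    expectation (\<lambda>\<omega>. (\<Sum>i\<in>insert i I. x i \<omega>)\<^sup>2) \<le> card (insert i I) * sqrt \<mu> \<and>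
    expectation (\<lambda>\<omega>. (\<Sum>i\<in>insert i I. x i \<omega>) ^ 4) \<le> 3 * (real (card (insert i I)))\<^sup>2 * \<mu>"
    if ind: "indep_vars (\<lambda>_. borel) x (insert i I)"
      and x4: "\<And>k. k \<in> insert i I \<Longrightarrow> integrable M (\<lambda>\<omega>. x k \<omega> ^ 4)"
      and x1: "\<And>k. k \<in> insert i I \<Longrightarrow> expectation (x k) = 0"
      and x4le: "\<And>k. k \<in> insert i I \<Longrightarrow> expectation (\<lambda>\<omega>. x k \<omega> ^ 4) \<le> \<mu>"
  proof -
    have xm: "x k \<in> borel_measurable M" if "k \<in> insert i I" for k
      using ind that by (auto simp: indep_vars_def)
    have [measurable]: "x i \<in> borel_measurable M" "?S \<in> borel_measurable M"
      using xm by auto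
    have IH_ind: "indep_vars (\<lambda>_. borel) x I" using ind by (rule indep_vars_subset) auto
    have IH: "integrable M (\<lambda>\<omega>. ?S \<omega> ^ 4)" "expectation ?S = 0"
        "expectation (\<lambda>\<omega>. (?S \<omega>)\<^sup>2) \<le> card I * sqrt \<mu>"
        "expectation (\<lambda>\<omega>. ?S \<omega> ^ 4) \<le> 3 * (real (card I))\<^sup>2 * \<mu>"
      by (rule insert.IH[OF IH_ind]; (rule x4 x1 x4le; simp))+
    have xk: "integrable M (\<lambda>\<omega>. x i \<omega> ^ k)" and Sk: "integrable M (\<lambda>\<omega>. ?S \<omega> ^ k)" if "k \<le> 4" for k
      using that by (rule integrable_power_le4[rotated 2]; simp add: x4 IH(1))+
    have iv: "indep_var borel (x i) borel ?S"
      using insert ind by (intro indep_vars_sum) auto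
    have ivp: "indep_var borel (\<lambda>\<omega>. x i \<omega> ^ k) borel (\<lambda>\<omega>. ?S \<omega> ^ l)" for k l
      using indep_var_compose[OF iv, of "\<lambda>t. t ^ k" borel "\<lambda>t. t ^ l" borel] by (simp add: comp_def)
    have P: "integrable M (\<lambda>\<omega>. x i \<omega> ^ k * ?S \<omega> ^ l)"
      "expectation (\<lambda>\<omega>. x i \<omega> ^ k * ?S \<omega> ^ l) = expectation (\<lambda>\<omega>. x i \<omega> ^ k) * expectation (\<lambda>\<omega>. ?S \<omega> ^ l)"
      if "k \<le> 4" "l \<le> 4" for k l
      using indep_var_integrable[OF ivp xk Sk] indep_var_lebesgue_integral[OF ivp xk Sk] that by auto
    \<comment> \<open>Factors with exponent 0 are kept so that every summand is an instance of
      \<open>P\<close>.\<close>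
    have 4: "(\<Sum>i\<in>insert i I. x i \<omega>) ^ 4 =
        x i \<omega> ^ 4 * ?S \<omega> ^ 0 + 4 * (x i \<omega> ^ 3 * ?S \<omega> ^ 1) + 6 * (x i \<omega> ^ 2 * ?S \<omega> ^ 2)
        + 4 * (x i \<omega> ^ 1 * ?S \<omega> ^ 3) + x i \<omega> ^ 0 * ?S \<omega> ^ 4" for \<omega>
      using insert by (simp add: power4_eq_xxxx power3_eq_cube power2_eq_square algebra_simps)
    have 2: "(\<Sum>i\<in>insert i I. x i \<omega>)\<^sup>2 =
        x i \<omega> ^ 2 * ?S \<omega> ^ 0 + 2 * (x i \<omega> ^ 1 * ?S \<omega> ^ 1) + x i \<omega> ^ 0 * ?S \<omega> ^ 2" for \<omega>
      using insert by (simp add: power2_eq_square algebra_simps)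
    have c: "card (insert i I) = Suc (card I)" using insert by simp
    have x2: "expectation (\<lambda>\<omega>. (x i \<omega>)\<^sup>2) \<le> sqrt \<mu>"
      using second_moment_le_sqrt_fourth[of "x i"] x4 x4le[of i]
      by (meson dual_order.trans insertI1 real_sqrt_le_mono \<open>x i \<in> borel_measurable M\<close>)
    have "integrable M (\<lambda>\<omega>. (\<Sum>i\<in>insert i I. x i \<omega>) ^ 4)"
      unfolding 4 by (intro Bochner_Integration.integrable_add integrable_mult_right P) auto
    moreover have "expectation (\<lambda>\<omega>. \<Sum>i\<in>insert i I. x i \<omega>) = 0"
      using insert xk[of 1] Sk[of 1] x1[of i] IH(2) by simp
    moreover have "expectation (\<lambda>\<omega>. (\<Sum>i\<in>insert i I. x i \<omega>)\<^sup>2)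
       = expectation (\<lambda>\<omega>. (x i \<omega>)\<^sup>2) + expectation (\<lambda>\<omega>. (?S \<omega>)\<^sup>2)"
      unfolding 2 using P[of 2 0] P[of 1 1] P[of 0 2] x1[of i] by (simp add: prob_space)
    moreover have "\<dots> \<le> card (insert i I) * sqrt \<mu>"
      using x2 IH(3) by (simp add: c algebra_simps)
    moreover have "expectation (\<lambda>\<omega>. (\<Sum>i\<in>insert i I. x i \<omega>) ^ 4) =
       expectation (\<lambda>\<omega>. x i \<omega> ^ 4) + 6 * (expectation (\<lambda>\<omega>. (x i \<omega>)\<^sup>2) * expectation (\<lambda>\<omega>. (?S \<omega>)\<^sup>2))
         + expectation (\<lambda>\<omega>. ?S \<omega> ^ 4)"
      unfolding 4 using P[of 4 0] P[of 3 1] P[of 2 2] P[of 1 3] P[of 0 4] x1[of i] IH(2)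
      by (simp add: prob_space)
    moreover have "\<dots> \<le> \<mu> + 6 * (sqrt \<mu> * (card I * sqrt \<mu>)) + 3 * (real (card I))\<^sup>2 * \<mu>"
      using x2 IH(3,4) x4le[of i] \<open>0 \<le> \<mu>\<close>
      by (intro add_mono mult_left_mono mult_mono) auto
    \<comment> \<open>With n the cardinality of \<open>I\<close> this is 1 + 6n + 3n^2 \<le> 3(n +
      1)^2. The constant 3 is what absorbs the middle term 6n.\<close>
    moreover have "\<dots> \<le> 3 * (real (card (insert i I)))\<^sup>2 * \<mu>"
    proof -
      have eq: "sqrt \<mu> * (card I * sqrt \<mu>) = card I * \<mu>"
        using \<open>0 \<le> \<mu>\<close> by (simp add: mult.left_commute)
      show ?thesis using \<open>0 \<le> \<mu>\<close> unfolding c eq by (simp add: power2_eq_square algebra_simps)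
    qed
    ultimately show ?thesis by linarith
  qed
  {
    case 1 then show ?case using main by blast
  next
    case 2 then show ?case using main by blast
  next
    case 3 then show ?case using main by blast
  next
    case 4 then show ?case using main by blast
  }
qed

end

section \<open>Fourth moments of innovations and of linear processes\<close>

context prob_space
begin

text \<open>A coordinate is a fixed measurable function of the pair of innovations, so it inherits
  independence across time, and its moments are determined by the common law of the pairs.\<close>

lemma iid_innovations_coordinate:
  fixes \<epsilon> :: "int \<Rightarrow> 'a \<Rightarrow> real ^ 'm::finite" and e :: "int \<Rightarrow> 'a \<Rightarrow> real ^ 'n::finite"
  assumes "iid_innovations M \<epsilon> e"
  shows "indep_vars (\<lambda>_. borel) (\<lambda>t \<omega>. \<epsilon> t \<omega> $ l) UNIV"
    and "\<epsilon> t \<in> borel_measurable M"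
    and "integrable M (\<lambda>\<omega>. (\<epsilon> t \<omega> $ l) ^ 4)"
    and "expectation (\<lambda>\<omega>. \<epsilon> t \<omega> $ l) = 0"
    and "expectation (\<lambda>\<omega>. (\<epsilon> t \<omega> $ l) ^ 4) = expectation (\<lambda>\<omega>. (\<epsilon> 0 \<omega> $ l) ^ 4)"
proof -
  let ?p = "\<lambda>t \<omega>. (\<epsilon> t \<omega>, e t \<omega>)"
  have ind: "indep_vars (\<lambda>_. borel) ?p UNIV"
    and dist: "distr M borel (?p t) = distr M borel (?p 0)"
    and mean: "(\<integral>\<omega>. \<epsilon> t \<omega> \<partial>M) = 0" for t
    using assms by (auto simp: iid_innovations_def)
  obtain a where a: "a > 0" "\<And>t. integrable M (\<lambda>\<omega>. norm (?p t \<omega>) powr (4 + a))"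
    using assms by (auto simp: iid_innovations_def)
  have fst: "(\<lambda>p::(real ^ 'm) \<times> (real ^ 'n). fst p) \<in> borel_measurable borel"
    by (intro borel_measurable_continuous_onI continuous_intros)
  have nth: "(\<lambda>p::(real ^ 'm) \<times> (real ^ 'n). fst p $ l) \<in> borel_measurable borel"
    by (intro borel_measurable_continuous_onI continuous_intros)
  have pm: "?p t \<in> borel_measurable M" for t
    using ind by (auto simp: indep_vars_def)
  show "indep_vars (\<lambda>_. borel) (\<lambda>t \<omega>. \<epsilon> t \<omega> $ l) UNIV"
    using indep_vars_compose2[OF ind, of "\<lambda>_ p. fst p $ l" "\<lambda>_. borel"] nth by simp
  show em[measurable]: "\<epsilon> t \<in> borel_measurable M" for t
    using measurable_compose[OF pm fst] by simp
  have en[measurable]: "(\<lambda>\<omega>. \<epsilon> t \<omega> $ l) \<in> borel_measurable M" for t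
    using measurable_compose[OF pm nth] by simp
  have le: "norm (\<epsilon> t \<omega>) ^ 4 \<le> 1 + norm (?p t \<omega>) powr (4 + a)" for t \<omega>
  proof -
    have "norm (\<epsilon> t \<omega>) ^ 4 \<le> norm (?p t \<omega>) ^ 4"
      by (intro power_mono norm_ge_zero) (metis fst_conv norm_fst_le)
    also have "\<dots> \<le> 1 + norm (?p t \<omega>) powr (4 + a)"
      using power4_le_powr[OF a(1), of "norm (?p t \<omega>)"] by simp
    finally show ?thesis .
  qed
  have n4: "integrable M (\<lambda>\<omega>. norm (\<epsilon> t \<omega>) ^ 4)" for t
    by (rule Bochner_Integration.integrable_bound[of M "\<lambda>\<omega>. 1 + norm (?p t \<omega>) powr (4 + a)"])
       (use a le in \<open>auto intro!: AE_I2\<close>)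
  have nth4: "(\<epsilon> t \<omega> $ l) ^ 4 \<le> norm (\<epsilon> t \<omega>) ^ 4" for t \<omega>
    using power_mono[OF component_le_norm_cart[of "\<epsilon> t \<omega>" l], of 4] by simp
  show "integrable M (\<lambda>\<omega>. (\<epsilon> t \<omega> $ l) ^ 4)"
    by (rule Bochner_Integration.integrable_bound[OF n4[of t]])
       (auto intro!: AE_I2 nth4)
  \<comment> \<open>The Bochner integral commutes with a coordinate projection for integrable
    functions. Without integrability a zero vector integral would say nothing about the
    coordinates.\<close>
  have "integrable M (\<lambda>\<omega>. norm (\<epsilon> t \<omega>))"
    using integrable_power_le4[OF _ n4[of t], of 1] by simp
  then have "integrable M (\<epsilon> t)" using em integrable_norm_iff by blast
  then have "expectation (\<lambda>\<omega>. \<epsilon> t \<omega> $ l) = (\<integral>\<omega>. \<epsilon> t \<omega> \<partial>M) $ l"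
    by (rule integral_bounded_linear[OF bounded_linear_vec_nth])
  then show "expectation (\<lambda>\<omega>. \<epsilon> t \<omega> $ l) = 0" by (simp add: mean)
  \<comment> \<open>The fourth moment is the integral of a fixed function against the law of the
    pair, and this law does not depend on \<open>t\<close>.\<close>
  have "(\<lambda>p::(real ^ 'm) \<times> (real ^ 'n). (fst p $ l) ^ 4) \<in> borel_measurable borel"
    using nth by simp
  then have eq: "expectation (\<lambda>\<omega>. (\<epsilon> t \<omega> $ l) ^ 4) = (\<integral>p. (fst p $ l) ^ 4 \<partial>distr M borel (?p t))" for t
    by (subst integral_distr[OF pm]) auto
  show "expectation (\<lambda>\<omega>. (\<epsilon> t \<omega> $ l) ^ 4) = expectation (\<lambda>\<omega>. (\<epsilon> 0 \<omega> $ l) ^ 4)"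
    unfolding eq[of t] eq[of 0] dist[of t] ..
qed

text \<open>The bound for independent scalars is applied to each coordinate and the coordinates are
  then summed. \<open>B\<close> does not depend on the index set, so it also covers all shifts of a
  window of times.\<close>

lemma iid_innovations_sum_fourth_moment:
  fixes \<epsilon> :: "int \<Rightarrow> 'a \<Rightarrow> real ^ 'm::finite" and e :: "int \<Rightarrow> 'a \<Rightarrow> real ^ 'n::finite"
  assumes iid: "iid_innovations M \<epsilon> e"
  obtains B where "0 \<le> B"
    "\<And>I. finite I \<Longrightarrow> integrable M (\<lambda>\<omega>. norm (\<Sum>t\<in>I. \<epsilon> t \<omega>) ^ 4) \<and>
       expectation (\<lambda>\<omega>. norm (\<Sum>t\<in>I. \<epsilon> t \<omega>) ^ 4) \<le> B * (real (card I))\<^sup>2"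
proof
  note [measurable] = iid_innovations_coordinate(2)[OF iid]
  define \<mu> where "\<mu> l = expectation (\<lambda>\<omega>. (\<epsilon> 0 \<omega> $ l) ^ 4)" for l
  define B where "B = real CARD('m) ^ 3 * (\<Sum>l\<in>UNIV. 3 * \<mu> l)"
  have \<mu>: "0 \<le> \<mu> l" for l unfolding \<mu>_def by simp
  show "0 \<le> B" unfolding B_def by (intro mult_nonneg_nonneg sum_nonneg) (auto simp: \<mu>)
  fix I :: "int set" assume I: "finite I"
  let ?S = "\<lambda>\<omega>. \<Sum>t\<in>I. \<epsilon> t \<omega>"
  have S: "integrable M (\<lambda>\<omega>. (?S \<omega> $ l) ^ 4)" "expectation (\<lambda>\<omega>. (?S \<omega> $ l) ^ 4) \<le> 3 * (real (card I))\<^sup>2 * \<mu> l"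
    for l
  proof -
    have "indep_vars (\<lambda>_. borel) (\<lambda>t \<omega>. \<epsilon> t \<omega> $ l) I"
      by (rule indep_vars_subset[OF iid_innovations_coordinate(1)[OF iid]]) simp
    note * = indep_sum_moments[OF I this iid_innovations_coordinate(3,4)[OF iid]
        eq_refl[OF iid_innovations_coordinate(5)[OF iid]], folded \<mu>_def, OF \<mu>]
    show "integrable M (\<lambda>\<omega>. (?S \<omega> $ l) ^ 4)" "expectation (\<lambda>\<omega>. (?S \<omega> $ l) ^ 4) \<le> 3 * (real (card I))\<^sup>2 * \<mu> l"
      using *(1,4) by (simp_all add: sum_component)
  qed
  have int: "integrable M (\<lambda>\<omega>. real CARD('m) ^ 3 * (\<Sum>l\<in>UNIV. (?S \<omega> $ l) ^ 4))"
    using S(1) by simp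
  have "integrable M (\<lambda>\<omega>. norm (?S \<omega>) ^ 4)"
    by (rule Bochner_Integration.integrable_bound[OF int])
       (auto intro!: AE_I2 order.trans[OF norm_fourth_power_le_sum])
  moreover have "expectation (\<lambda>\<omega>. norm (?S \<omega>) ^ 4) \<le> expectation (\<lambda>\<omega>. real CARD('m) ^ 3 * (\<Sum>l\<in>UNIV. (?S \<omega> $ l) ^ 4))"
    by (rule integral_mono[OF calculation int norm_fourth_power_le_sum])
  moreover have "\<dots> = real CARD('m) ^ 3 * (\<Sum>l\<in>UNIV. expectation (\<lambda>\<omega>. (?S \<omega> $ l) ^ 4))"
    using S(1) by simp
  moreover have "\<dots> \<le> real CARD('m) ^ 3 * (\<Sum>l\<in>UNIV. 3 * (real (card I))\<^sup>2 * \<mu> l)"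
    by (intro mult_left_mono sum_mono S) simp
  moreover have "\<dots> = B * (real (card I))\<^sup>2"
    unfolding B_def by (simp add: sum_distrib_left sum_distrib_right mult_ac)
  ultimately show "integrable M (\<lambda>\<omega>. norm (?S \<omega>) ^ 4) \<and> expectation (\<lambda>\<omega>. norm (?S \<omega>) ^ 4) \<le> B * (real (card I))\<^sup>2"
    by linarith
qed

text \<open>Exchanging the sums over times and lags writes the partial sum as a series over
  \<open>j\<close> of \<open>C j\<close> applied to a sum of \<open>n\<close> innovations. A lag
  only shifts the window, so each of these sums has a fourth moment of order \<open>n^2\<close>,
  uniformly in \<open>j\<close>, and the weights \<open>norm (C j)\<close> are summable.\<close>

lemma linear_process_partial_sum_fourth_moment:
  fixes C :: "nat \<Rightarrow> real ^ 'm::finite ^ 'q::finite"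
    and \<epsilon> :: "int \<Rightarrow> 'a \<Rightarrow> real ^ 'm" and e :: "int \<Rightarrow> 'a \<Rightarrow> real ^ 'n::finite"
  assumes iid: "iid_innovations M \<epsilon> e" and lin: "linear_process M C \<epsilon> u"
  obtains B where "0 \<le> B"
    "\<And>n. (\<integral>\<^sup>+\<omega>. ennreal (norm (\<Sum>t=1..n. u (int t) \<omega>) ^ 4) \<partial>M) \<le> ennreal (B * (real n)\<^sup>2)"
proof -
  note [measurable] = iid_innovations_coordinate(2)[OF iid]
  obtain B where B: "0 \<le> B" 
    "\<And>I. finite I \<Longrightarrow> integrable M (\<lambda>\<omega>. norm (\<Sum>t\<in>I. \<epsilon> t \<omega>) ^ 4)"
    "\<And>I. finite I \<Longrightarrow> expectation (\<lambda>\<omega>. norm (\<Sum>t\<in>I. \<epsilon> t \<omega>) ^ 4) \<le> B * (real (card I))\<^sup>2"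
    using iid_innovations_sum_fourth_moment[OF iid] by metis
  \<comment> \<open>For \<open>j \<ge> 1\<close> the factor \<open>real j\<close> is at least 1, so
    the weighted condition on the filter implies plain summability.\<close>
  have sC: "summable (\<lambda>j. norm (C j))"
  proof (rule summable_comparison_test_ev)
    show "summable (\<lambda>j. real j * norm (C j))" using lin by (simp add: linear_process_def)
    show "\<forall>\<^sub>F j in sequentially. norm (norm (C j)) \<le> real j * norm (C j)"
      using eventually_ge_at_top[of 1]
      by eventually_elim (simp add: mult_le_cancel_right1)
  qed
  define A where "A = (\<Sum>j. norm (C j))"
  have A0: "0 \<le> A" unfolding A_def by (rule suminf_nonneg[OF sC]) simp
  have A: "(\<Sum>j<J. norm (C j)) \<le> A" for J unfolding A_def by (rule sum_le_suminf[OF sC]) auto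
  show ?thesis
  proof (rule that[of "A ^ 4 * B"])
    fix n
    \<comment> \<open>The innovations that enter at lag \<open>j\<close>: the window of
      \<open>n\<close> times, shifted back by \<open>j\<close>.\<close>
    define S where "S j \<omega> = (\<Sum>t=1..n. \<epsilon> (int t - int j) \<omega>)" for j \<omega>
    have S_eq: "S j \<omega> = (\<Sum>k\<in>(\<lambda>t. int t - int j) ` {1..n}. \<epsilon> k \<omega>)" for j \<omega>
      unfolding S_def by (subst sum.reindex) (auto simp: inj_on_def)
    have card: "card ((\<lambda>t. int t - int j) ` {1..n}) = n" for j
      by (subst card_image) (auto simp: inj_on_def)
    have S: "integrable M (\<lambda>\<omega>. norm (S j \<omega>) ^ 4)" "expectation (\<lambda>\<omega>. norm (S j \<omega>) ^ 4) \<le> B * (real n)\<^sup>2" for j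
      using B(2,3)[of "(\<lambda>t. int t - int j) ` {1..n}"] unfolding S_eq card by simp_all
    have [measurable]: "S j \<in> borel_measurable M" for j unfolding S_def by simp
    \<comment> \<open>The contribution of the lags below \<open>J\<close> to the partial
      sum.\<close>
    define V where "V J \<omega> = (\<Sum>j<J. C j *v S j \<omega>)" for J \<omega>
    have Vm[measurable]: "V J \<in> borel_measurable M" for J
      unfolding V_def
      by (intro borel_measurable_sum borel_measurable_matrix_vector_mult) auto
    have Vle: "norm (V J \<omega>) ^ 4 \<le> A ^ 3 * (\<Sum>j<J. norm (C j) * norm (S j \<omega>) ^ 4)" for J \<omega>
    proof -
      have "norm (V J \<omega>) \<le> (\<Sum>j<J. norm (C j) * norm (S j \<omega>))"
        unfolding V_def by (intro sum_norm_le norm_matrix_vector_le_Frobenius)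
      then have "norm (V J \<omega>) ^ 4 \<le> (\<Sum>j<J. norm (C j) * norm (S j \<omega>)) ^ 4"
        by (intro power_mono) auto
      also have "\<dots> \<le> (\<Sum>j<J. norm (C j)) ^ 3 * (\<Sum>j<J. norm (C j) * norm (S j \<omega>) ^ 4)"
        by (rule sum_fourth_power_le) simp
      also have "\<dots> \<le> A ^ 3 * (\<Sum>j<J. norm (C j) * norm (S j \<omega>) ^ 4)"
        by (intro mult_right_mono power_mono A sum_nonneg mult_nonneg_nonneg) auto
      finally show ?thesis .
    qed
    have VB: "(\<integral>\<^sup>+\<omega>. ennreal (norm (V J \<omega>) ^ 4) \<partial>M) \<le> ennreal (A ^ 4 * B * (real n)\<^sup>2)" for J
    proof -
      have "(\<integral>\<^sup>+\<omega>. ennreal (norm (V J \<omega>) ^ 4) \<partial>M)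
          \<le> (\<integral>\<^sup>+\<omega>. ennreal (A ^ 3 * (\<Sum>j<J. norm (C j) * norm (S j \<omega>) ^ 4)) \<partial>M)"
        by (intro nn_integral_mono ennreal_leI Vle)
      also have "\<dots> = ennreal (expectation (\<lambda>\<omega>. A ^ 3 * (\<Sum>j<J. norm (C j) * norm (S j \<omega>) ^ 4)))"
        using S(1) A0 by (intro nn_integral_eq_integral) (auto intro!: AE_I2 mult_nonneg_nonneg sum_nonneg)
      also have "\<dots> = ennreal (A ^ 3 * (\<Sum>j<J. norm (C j) * expectation (\<lambda>\<omega>. norm (S j \<omega>) ^ 4)))"
        using S(1) by simp
      also have "\<dots> \<le> ennreal (A ^ 3 * (\<Sum>j<J. norm (C j) * (B * (real n)\<^sup>2)))"
        using A0 by (intro ennreal_leI mult_left_mono sum_mono S) auto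
      also have "\<dots> \<le> ennreal (A ^ 3 * (A * (B * (real n)\<^sup>2)))"
        unfolding sum_distrib_right[symmetric]
        using A0 B(1) by (intro ennreal_leI mult_left_mono mult_right_mono A) auto
      finally show ?thesis by (simp add: power_def algebra_simps numeral_eq_Suc)
    qed
    let ?U = "\<lambda>\<omega>. \<Sum>t=1..n. u (int t) \<omega>"
    \<comment> \<open>Only finitely many times occur, so the series converge at all of them outside
      one null set.\<close>
    have "AE \<omega> in M. \<forall>t\<in>{1..n}. (\<lambda>j. C j *v \<epsilon> (int t - int j) \<omega>) sums u (int t) \<omega>"
      using lin by (intro AE_finite_allI) (auto simp: linear_process_def)
    then have lim: "AE \<omega> in M. (\<lambda>J. V J \<omega>) \<longlonglongrightarrow> ?U \<omega>"
    proof eventually_elim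
      case (elim \<omega>)
      then have "(\<lambda>j. \<Sum>t=1..n. C j *v \<epsilon> (int t - int j) \<omega>) sums ?U \<omega>"
        by (intro sums_sum) auto
      then show ?case by (simp add: sums_def V_def S_def linear_sum[OF matrix_vector_mul_linear] sum.swap[of _ _ "{1..n}"])
    qed
    \<comment> \<open>Almost surely the truncated sums converge, so the integrand can be written as
      the liminf to which Fatou's lemma applies.\<close>
    have "(\<integral>\<^sup>+\<omega>. ennreal (norm (?U \<omega>) ^ 4) \<partial>M) = (\<integral>\<^sup>+\<omega>. liminf (\<lambda>J. ennreal (norm (V J \<omega>) ^ 4)) \<partial>M)"
    proof (rule nn_integral_cong_AE, use lim in eventually_elim)
      case (elim \<omega>)
      have "(\<lambda>J. ennreal (norm (V J \<omega>) ^ 4)) \<longlonglongrightarrow> ennreal (norm (?U \<omega>) ^ 4)"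
        by (intro tendsto_intros elim)
      then show ?case by (intro lim_imp_Liminf[symmetric]) auto
    qed
    also have "\<dots> \<le> liminf (\<lambda>J. \<integral>\<^sup>+\<omega>. ennreal (norm (V J \<omega>) ^ 4) \<partial>M)"
      by (rule nn_integral_liminf) measurable
    also have "\<dots> \<le> ennreal (A ^ 4 * B * (real n)\<^sup>2)"
      by (intro Liminf_le always_eventually allI VB) simp
    finally show "(\<integral>\<^sup>+\<omega>. ennreal (norm (?U \<omega>) ^ 4) \<partial>M) \<le> ennreal (A ^ 4 * B * (real n)\<^sup>2)" .
  qed (use A0 B in simp)
qed

end

section \<open>Prediction error of the group LASSO when the tail sums are bounded\<close>

lemma transpose_commutation_matrix_mult:
  "(transpose commutation_matrix *v x) $ b = x $ prod.swap b"
  by (simp add: transpose_def commutation_matrix_def matrix_vector_mult_def if_distrib[of "\<lambda>c. c * _"]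
      cong: if_cong)

lemma norm_transpose_commutation_matrix_mult:
  fixes x :: "real ^ ('q::finite \<times> 'k::finite)"
  shows "norm (transpose commutation_matrix *v x) = norm x"
proof -
  have "(\<Sum>b\<in>UNIV. (x $ prod.swap b)\<^sup>2) = (\<Sum>b\<in>UNIV. (x $ b)\<^sup>2)"
    by (rule sum.reindex_bij_betw) simp
  then show ?thesis
    unfolding norm_vec_def L2_set_def transpose_commutation_matrix_mult real_norm_def power2_abs
    by (rule arg_cong)
qed

text \<open>The adjoint of \<open>z' \<otimes> I\<close> maps \<open>u\<close> to
  \<open>z \<otimes> u\<close>. This turns the cross term into inner products of the score with the
  coefficients.\<close>

lemma inner_row_kronecker_mat_1:
  fixes u :: "real ^ 'q::finite" and v :: "real ^ ('k::finite \<times> 'q)"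
  shows "u \<bullet> (row_kronecker z (mat 1) *v v) = (\<chi> p. z $ fst p * u $ snd p) \<bullet> v"
proof -
  have "u v* row_kronecker z (mat 1) = (\<chi> p. z $ fst p * u $ snd p)"
    by (simp add: vec_eq_iff vector_matrix_mult_def row_kronecker_def mat_def if_distrib
        mult.assoc cong: if_cong)
  then show ?thesis by (simp add: dot_lmul_matrix[symmetric])
qed

lemma design_apply_diff:
  "design_apply T x w (\<lambda>i. \<theta> i - \<theta>' i) t = design_apply T x w \<theta> t - design_apply T x w \<theta>' t"
  by (simp add: design_apply_def matrix_vector_mult_diff_distrib sum_subtractf)

lemma stacked_norm_squared: "(stacked_norm T v)\<^sup>2 = (\<Sum>t=1..T. (norm (v t))\<^sup>2)"
  by (simp add: stacked_norm_def L2_set_def sum_nonneg)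

lemma sum_triangle_swap:
  fixes h :: "nat \<Rightarrow> nat \<Rightarrow> 'b::comm_monoid_add"
  shows "(\<Sum>t=1..T. \<Sum>i=1..t. h t i) = (\<Sum>i=1..T. \<Sum>t=i..T. h t i)"
proof -
  have "(\<Sum>t=1..T. \<Sum>i=1..t. h t i) = (\<Sum>t=1..T. \<Sum>i\<in>{i. i \<in> {1..T} \<and> i \<le> t}. h t i)"
    by (intro sum.cong) auto
  also have "\<dots> = (\<Sum>i=1..T. \<Sum>t\<in>{t. t \<in> {1..T} \<and> i \<le> t}. h t i)"
    by (rule sum.swap_restrict) auto
  also have "\<dots> = (\<Sum>i=1..T. \<Sum>t=i..T. h t i)"
    by (intro sum.cong) auto
  finally show ?thesis .
qed

text \<open>The block \<open>\<theta> i\<close> acts at all times \<open>t \<ge> i\<close>, so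
  exchanging the sums pairs it with the tail of the score from \<open>i\<close> on. Such a tail has
  \<open>d\<close> coordinates, each at most \<open>b\<close> in absolute value, hence norm at most
  \<open>d * b\<close>; the commutation matrix preserves the norm of
  \<open>\<theta> i\<close>.\<close>

lemma design_cross_term_le:
  fixes \<theta> :: "nat \<Rightarrow> ('q::finite, 'r::finite, 's::finite) coeff"
  assumes b: "\<And>i k j. i \<in> {1..T} \<Longrightarrow>
      \<bar>\<Sum>t=i..T. regressor_vec T t (x t) (w t) $ k * u t $ j\<bar> \<le> b"
  shows "(\<Sum>t=1..T. u t \<bullet> design_apply T x w \<theta> t)
     \<le> real (CARD('q) * (CARD('r) + 2 + CARD('s))) * b * (\<Sum>i=1..T. norm (\<theta> i))"
proof -
  let ?K = "\<lambda>i. transpose commutation_matrix *v \<theta> i"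
  define g where "g t = (\<chi> p. regressor_vec T t (x t) (w t) $ fst p * u t $ snd p)" for t
  let ?d = "real (CARD('q) * (CARD('r) + 2 + CARD('s)))"
  have tail: "norm (\<Sum>t=i..T. g t) \<le> ?d * b" if "i \<in> {1..T}" for i
  proof -
    have "norm (\<Sum>t=i..T. g t) \<le> (\<Sum>p\<in>UNIV. \<bar>(\<Sum>t=i..T. g t) $ p\<bar>)"
      by (rule norm_le_l1_cart)
    also have "\<dots> \<le> real CARD(('r, 's) regressor \<times> 'q) * b"
      by (rule sum_bounded_above) (use b[OF that] in \<open>simp add: g_def sum_component\<close>)
    also have "CARD(('r, 's) regressor \<times> 'q) = CARD('q) * (CARD('r) + 2 + CARD('s))"
      by (simp add: algebra_simps)
    finally show ?thesis .
  qed
  have "(\<Sum>t=1..T. u t \<bullet> design_apply T x w \<theta> t) = (\<Sum>t=1..T. \<Sum>i=1..t. g t \<bullet> ?K i)"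
    by (simp add: design_apply_def Zbar_def inner_row_kronecker_mat_1 inner_sum_right g_def)
  also have "\<dots> = (\<Sum>i=1..T. \<Sum>t=i..T. g t \<bullet> ?K i)"
    by (rule sum_triangle_swap)
  also have "\<dots> = (\<Sum>i=1..T. (\<Sum>t=i..T. g t) \<bullet> ?K i)" by (simp add: inner_sum_left)
  also have "\<dots> \<le> (\<Sum>i=1..T. norm (\<Sum>t=i..T. g t) * norm (?K i))"
    by (intro sum_mono norm_cauchy_schwarz)
  also have "\<dots> \<le> (\<Sum>i=1..T. ?d * b * norm (\<theta> i))"
    unfolding norm_transpose_commutation_matrix_mult
    by (intro sum_mono mult_right_mono tail) auto
  finally show ?thesis by (simp add: sum_distrib_left)
qed

text \<open>The estimator is compared with \<open>\<theta>0\<close>, and the squared errors cancel.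
  The condition on \<open>lam\<close> says that it is at least \<open>2 * d * b / T\<close>, the
  factor that bounds the cross term.\<close>

lemma group_lasso_prediction_error_le:
  fixes \<theta> \<theta>0 :: "nat \<Rightarrow> ('q::finite, 'r::finite, 's::finite) coeff"
  assumes "0 < T" and "0 \<le> lam" and lasso: "is_group_lasso T lam x w y \<theta>"
    and y: "\<And>t. t \<in> {1..T} \<Longrightarrow> y t = design_apply T x w \<theta>0 t + u t"
    and b: "\<And>i k j. i \<in> {1..T} \<Longrightarrow>
      \<bar>\<Sum>t=i..T. regressor_vec T t (x t) (w t) $ k * u t $ j\<bar> \<le> b"
    and lam: "2 * real (CARD('q) * (CARD('r) + 2 + CARD('s))) * b \<le> lam * real T"
  shows "1 / real T * (stacked_norm T (design_apply T x w (\<lambda>i. \<theta> i - \<theta>0 i)))\<^sup>2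
    \<le> 2 * lam * (\<Sum>i=1..T. norm (\<theta>0 i))"
proof -
  let ?\<Delta> = "\<lambda>i. \<theta> i - \<theta>0 i"
  let ?D = "design_apply T x w ?\<Delta>"
  let ?d = "real (CARD('q) * (CARD('r) + 2 + CARD('s)))"
  let ?n = "\<lambda>\<theta>. \<Sum>i=1..T. norm (\<theta> i)"
  let ?U = "\<Sum>t=1..T. (norm (u t))\<^sup>2" and ?E = "\<Sum>t=1..T. (norm (?D t))\<^sup>2"
  let ?X = "\<Sum>t=1..T. u t \<bullet> ?D t"
  have obj0: "group_lasso_objective T lam x w y \<theta>0 = ?U / T + lam * ?n \<theta>0"
    by (simp add: group_lasso_objective_def stacked_norm_squared y)
  have "(\<Sum>t=1..T. (norm (y t - design_apply T x w \<theta> t))\<^sup>2) = (\<Sum>t=1..T. (norm (u t - ?D t))\<^sup>2)"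
    by (intro sum.cong refl) (simp add: y design_apply_diff algebra_simps)
  also have "\<dots> = (\<Sum>t=1..T. (norm (u t))\<^sup>2 - 2 * (u t \<bullet> ?D t) + (norm (?D t))\<^sup>2)"
    by (intro sum.cong refl) (simp add: power2_norm_eq_inner inner_diff inner_commute)
  also have "\<dots> = ?U - 2 * ?X + ?E"
    by (simp add: sum.distrib sum_subtractf sum_distrib_left)
  finally have obj1: "group_lasso_objective T lam x w y \<theta> = (?U - 2 * ?X + ?E) / T + lam * ?n \<theta>"
    by (simp add: group_lasso_objective_def stacked_norm_squared)
  have "(?U - 2 * ?X + ?E) / T + lam * ?n \<theta> \<le> ?U / T + lam * ?n \<theta>0"
    using lasso unfolding is_group_lasso_def obj0[symmetric] obj1[symmetric] by blast
  then have "?E / T \<le> 2 * ?X / T + lam * (?n \<theta>0 - ?n \<theta>)"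
    by (simp add: add_divide_distrib diff_divide_distrib algebra_simps)
  also have "2 * ?X / T \<le> lam * ?n ?\<Delta>"
  proof -
    have "2 * ?X \<le> 2 * ?d * b * ?n ?\<Delta>"
      using mult_left_mono[OF design_cross_term_le[of T x w u b ?\<Delta>, OF b], of 2] by (simp only: mult.assoc)
    also have "\<dots> \<le> lam * real T * ?n ?\<Delta>"
      by (intro mult_right_mono lam sum_nonneg) auto
    finally show ?thesis using \<open>0 < T\<close> by (simp add: field_simps)
  qed
  \<comment> \<open>By the triangle inequality the penalty of the difference is at most the sum of
    both penalties; the penalty of \<open>\<theta>\<close> then cancels.\<close>
  also have "lam * ?n ?\<Delta> + lam * (?n \<theta>0 - ?n \<theta>) \<le> 2 * lam * ?n \<theta>0"
  proof -
    have "?n ?\<Delta> \<le> (\<Sum>i=1..T. norm (\<theta> i) + norm (\<theta>0 i))"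
      by (intro sum_mono norm_triangle_ineq4)
    then have "lam * ?n ?\<Delta> \<le> lam * (?n \<theta> + ?n \<theta>0)"
      using \<open>0 \<le> lam\<close> by (intro mult_left_mono) (auto simp: sum.distrib)
    then show ?thesis by (simp add: algebra_simps)
  qed
  finally show ?thesis by (simp add: stacked_norm_squared)
qed

text \<open>At most \<open>m0 + 1\<close> blocks are nonzero: the baseline and the changes at the
  breakpoints.\<close>

lemma sum_norm_le_max_magnitude:
  assumes "has_breaks T m0 bp \<theta>"
  shows "(\<Sum>i=1..T. norm (\<theta> i)) \<le> real (m0 + 1) * max_magnitude m0 bp \<theta>"
proof -
  let ?S = "{i \<in> {1..T}. \<theta> i \<noteq> 0}"
  have bp: "bp 0 = 1" "{i \<in> {2..T}. \<theta> i \<noteq> 0} = bp ` {1..m0}"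
    using assms by (auto simp: has_breaks_def)
  \<comment> \<open>\<open>max_magnitude\<close> evaluates \<open>bp\<close> at \<open>j - 1\<close>
    for \<open>j\<close> from 1 on, so the block at \<open>bp j\<close> appears under the index
    \<open>Suc j\<close>, and \<open>j = 0\<close> is the baseline.\<close>
  have le: "norm (\<theta> (bp j)) \<le> max_magnitude m0 bp \<theta>" if "j \<le> m0" for j
    unfolding max_magnitude_def using that
    by (intro Max_ge) (auto intro!: image_eqI[of _ _ "Suc j"])
  have S: "?S \<subseteq> bp ` {0..m0}"
  proof
    fix i assume i: "i \<in> ?S"
    show "i \<in> bp ` {0..m0}"
    proof (cases "i = 1")
      case True then show ?thesis using bp(1) by (intro image_eqI[of _ _ 0]) auto
    next
      case False
      then have "i \<in> bp ` {1..m0}" using i unfolding bp(2)[symmetric] by auto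
      then show ?thesis by auto
    qed
  qed
  have card: "card ?S \<le> m0 + 1"
    using card_mono[OF _ S] card_image_le[of "{0..m0}" bp] by simp
  have nonneg: "0 \<le> max_magnitude m0 bp \<theta>" using le[of 0] norm_ge_zero order.trans by blast
  have "(\<Sum>i=1..T. norm (\<theta> i)) = (\<Sum>i\<in>?S. norm (\<theta> i))"
    by (rule sum.mono_neutral_right) auto
  also have "\<dots> \<le> real (card ?S) * max_magnitude m0 bp \<theta>"
    by (rule sum_bounded_above) (use S le in fastforce)
  also have "\<dots> \<le> real (m0 + 1) * max_magnitude m0 bp \<theta>"
    using card nonneg by (intro mult_right_mono) auto
  finally show ?thesis .
qed

section \<open>From tail sums to partial sums\<close>

lemma tail_sum_le:
  fixes a :: "nat \<Rightarrow> real"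
  assumes "\<And>n. n \<le> T \<Longrightarrow> \<bar>\<Sum>t=1..n. a t\<bar> \<le> b" and "1 \<le> i" "i \<le> T + 1"
  shows "\<bar>\<Sum>t=i..T. a t\<bar> \<le> 2 * b"
proof -
  \<comment> \<open>The tail is the difference of two partial sums, which costs the factor 2. For
    \<open>i = 1\<close> the first one is empty, and for \<open>i = T + 1\<close> the tail
    is.\<close>
  have "{1..T} = {1..i - 1} \<union> {i..T}" using assms(2,3) by auto
  then have "(\<Sum>t=1..T. a t) = (\<Sum>t=1..i - 1. a t) + (\<Sum>t=i..T. a t)"
    using assms(2) by (simp add: sum.union_disjoint)
  moreover have "\<bar>\<Sum>t=1..i - 1. a t\<bar> \<le> b" using assms(3) by (intro assms(1)) simp
  moreover have "\<bar>\<Sum>t=1..T. a t\<bar> \<le> b" by (rule assms(1)) simp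
  ultimately show ?thesis by linarith
qed

text \<open>Writing \<open>t\<close> as a sum of \<open>t\<close> ones turns the weighted tail sum into \<open>T\<close> plain tail sums.\<close>

lemma trend_tail_sum_le:
  fixes a :: "nat \<Rightarrow> real"
  assumes a: "\<And>n. n \<le> T \<Longrightarrow> \<bar>\<Sum>t=1..n. a t\<bar> \<le> b" and i: "1 \<le> i" "i \<le> T"
  shows "\<bar>\<Sum>t=i..T. real t / real T * a t\<bar> \<le> 2 * b"
proof -
  have "(\<Sum>t=i..T. real t * a t) = (\<Sum>t=i..T. \<Sum>s\<in>{s. s \<in> {1..T} \<and> s \<le> t}. a t)"
  proof (rule sum.cong)
    fix t assume "t \<in> {i..T}"
    then have "{s. s \<in> {1..T} \<and> s \<le> t} = {1..t}" by auto
    then show "real t * a t = (\<Sum>s\<in>{s. s \<in> {1..T} \<and> s \<le> t}. a t)" by simp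
  qed simp
  also have "\<dots> = (\<Sum>s=1..T. \<Sum>t\<in>{t. t \<in> {i..T} \<and> s \<le> t}. a t)"
    by (rule sum.swap_restrict) auto
  also have "\<bar>\<dots>\<bar> \<le> (\<Sum>s=1..T. 2 * b)"
  proof (rule order.trans[OF sum_abs sum_mono])
    fix s assume s: "s \<in> {1..T}"
    have "{t. t \<in> {i..T} \<and> s \<le> t} = {max i s..T}" by auto
    then show "\<bar>\<Sum>t\<in>{t. t \<in> {i..T} \<and> s \<le> t}. a t\<bar> \<le> 2 * b"
      using tail_sum_le[of T a b "max i s", OF a] s i by auto
  qed
  finally have "\<bar>\<Sum>t=i..T. real t * a t\<bar> \<le> real T * (2 * b)" by simp
  moreover have "(\<Sum>t=i..T. real t / real T * a t) = (\<Sum>t=i..T. real t * a t) / real T"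
    by (simp add: sum_divide_distrib)
  ultimately show ?thesis using i by (simp add: abs_divide pos_divide_le_eq mult.commute)
qed

text \<open>\<^term>\<open>regressor_vec T T\<close> has the trend frozen at \<open>1\<close>, so that its trend coordinate is covered by
  the moment bound for the partial sums of the errors.\<close>

lemma regressor_tail_sum_le:
  assumes "\<And>n. n \<le> T \<Longrightarrow> \<bar>\<Sum>t=1..n. regressor_vec T T (x t) (w t) $ k * v t\<bar> \<le> b"
    and "1 \<le> i" "i \<le> T"
  shows "\<bar>\<Sum>t=i..T. regressor_vec T t (x t) (w t) $ k * v t\<bar> \<le> 2 * b"
proof (cases "k = Inr (Inl 1)")
  case True
  then have "\<bar>\<Sum>t=1..n. v t\<bar> \<le> b" if "n \<le> T" for n
    using assms(1)[OF that] assms(2,3) by (simp add: regressor_vec_def)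
  from trend_tail_sum_le[OF this assms(2,3)] show ?thesis
    using True by (simp add: regressor_vec_def)
next
  \<comment> \<open>Only the trend coordinate depends on the time argument, so freezing it leaves
    all others unchanged.\<close>
  case False
  then have "regressor_vec T t (x t) (w t) $ k = regressor_vec T T (x t) (w t) $ k" for t
    by (auto simp: regressor_vec_def split: sum.splits)
  then show ?thesis using tail_sum_le[OF assms(1)] assms(2,3) by simp
qed

section \<open>Measurability of the regressors and of the design\<close>

lemma borel_measurable_vec_nth:
  fixes f :: "'a \<Rightarrow> real ^ 'n::finite"
  shows "f \<in> borel_measurable M \<Longrightarrow> (\<lambda>\<omega>. f \<omega> $ i) \<in> borel_measurable M"
  by (rule measurable_compose[OF _ borel_measurable_nth])

lemma borel_measurable_regressor_vec:
  assumes "x \<in> borel_measurable M" "w \<in> borel_measurable M"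
  shows "(\<lambda>\<omega>. regressor_vec T t (x \<omega>) (w \<omega>) $ k) \<in> borel_measurable M"
proof (cases k)
  case (Inl l)
  then have "(\<lambda>\<omega>. regressor_vec T t (x \<omega>) (w \<omega>) $ k) = (\<lambda>\<omega>. real T powr (- 1/2) * x \<omega> $ l)"
    by (simp add: regressor_vec_def)
  then show ?thesis
    by (simp only:) (intro borel_measurable_times borel_measurable_const borel_measurable_vec_nth assms)
next
  case (Inr m)
  show ?thesis
  proof (cases m)
    case Inl': (Inl b)
    then have "(\<lambda>\<omega>. regressor_vec T t (x \<omega>) (w \<omega>) $ k) = (\<lambda>\<omega>. if b = 1 then real t / real T else 1)"
      using Inr by (simp add: regressor_vec_def)
    then show ?thesis by (simp only: borel_measurable_const)
  next
    case Inr': (Inr l)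
    then have "(\<lambda>\<omega>. regressor_vec T t (x \<omega>) (w \<omega>) $ k) = (\<lambda>\<omega>. w \<omega> $ l)"
      using Inr by (simp add: regressor_vec_def)
    then show ?thesis by (simp only:) (intro borel_measurable_vec_nth assms)
  qed
qed

lemma borel_measurable_design_apply:
  fixes \<theta> :: "nat \<Rightarrow> 'a \<Rightarrow> ('q::finite, 'r::finite, 's::finite) coeff"
  assumes "x t \<in> borel_measurable M" "w t \<in> borel_measurable M"
    and "\<And>i. \<theta> i \<in> borel_measurable M"
  shows "(\<lambda>\<omega>. design_apply T (\<lambda>t. x t \<omega>) (\<lambda>t. w t \<omega>) (\<lambda>i. \<theta> i \<omega>) t) \<in> borel_measurable M"
  unfolding design_apply_def
proof (intro borel_measurable_matrix_vector_mult borel_measurable_sum assms(3))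
  show "(\<lambda>\<omega>. Zbar T t (x t \<omega>) (w t \<omega>) $ i $ j) \<in> borel_measurable M" for i :: 'q and j
    using borel_measurable_regressor_vec[OF assms(1,2)]
    by (simp add: Zbar_def row_kronecker_def)
qed simp

section \<open>Fourth moments of the partial sums of the score\<close>

lemma (in prob_space) nn_integral_power4_le:
  assumes [measurable]: "P \<in> borel_measurable M" and "0 < a"
    and "(\<integral>\<^sup>+\<omega>. ennreal (\<bar>P \<omega>\<bar> powr (4 + a)) \<partial>M) \<le> ennreal c" and "0 \<le> c"
  shows "(\<integral>\<^sup>+\<omega>. ennreal (\<bar>P \<omega>\<bar> ^ 4) \<partial>M) \<le> ennreal (1 + c)"
proof -
  have "(\<integral>\<^sup>+\<omega>. ennreal (\<bar>P \<omega>\<bar> ^ 4) \<partial>M) \<le> (\<integral>\<^sup>+\<omega>. 1 + ennreal (\<bar>P \<omega>\<bar> powr (4 + a)) \<partial>M)"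
    using power4_le_powr[OF \<open>0 < a\<close>]
    by (intro nn_integral_mono) (simp add: ennreal_plus[symmetric] del: ennreal_plus flip: ennreal_1)
  also have "\<dots> = 1 + (\<integral>\<^sup>+\<omega>. ennreal (\<bar>P \<omega>\<bar> powr (4 + a)) \<partial>M)"
    by (subst nn_integral_add) (auto simp: emeasure_space_1)
  also have "\<dots> \<le> 1 + ennreal c" using assms(3) by (rule add_left_mono)
  also have "\<dots> = ennreal (1 + c)" using assms(4) by simp
  finally show ?thesis .
qed

lemma nn_integral_cmult_power4:
  assumes [measurable]: "P \<in> borel_measurable M" and "(\<integral>\<^sup>+\<omega>. ennreal (\<bar>P \<omega>\<bar> ^ 4) \<partial>M) \<le> ennreal B"
    and Q: "\<And>\<omega>. Q \<omega> = c * P \<omega>"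
  shows "(\<integral>\<^sup>+\<omega>. ennreal (\<bar>Q \<omega>\<bar> ^ 4) \<partial>M) \<le> ennreal (c ^ 4 * B)"
proof -
  have "(\<integral>\<^sup>+\<omega>. ennreal (\<bar>Q \<omega>\<bar> ^ 4) \<partial>M) = (\<integral>\<^sup>+\<omega>. ennreal (c ^ 4) * ennreal (\<bar>P \<omega>\<bar> ^ 4) \<partial>M)"
    by (simp add: Q abs_mult power_mult_distrib ennreal_mult)
  also have "\<dots> = ennreal (c ^ 4) * (\<integral>\<^sup>+\<omega>. ennreal (\<bar>P \<omega>\<bar> ^ 4) \<partial>M)"
    by (rule nn_integral_cmult) simp
  also have "\<dots> \<le> ennreal (c ^ 4) * ennreal B" using assms(2) by (rule mult_left_mono) simp
  also have "\<dots> = ennreal (c ^ 4 * B)" by (simp add: ennreal_mult'[symmetric])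
  finally show ?thesis .
qed

lemma (in prob_space) score_fourth_moment:
  fixes C :: "nat \<Rightarrow> real ^ 'm::finite ^ 'q::finite" and D :: "nat \<Rightarrow> real ^ 'n::finite ^ 'r::finite"
    and w :: "int \<Rightarrow> 'a \<Rightarrow> real ^ 's::finite"
  assumes A: "assumption_A M C D \<epsilon> e u \<xi> X w" and X: "\<And>t. X t \<in> borel_measurable M"
  shows "\<exists>B\<ge>0. \<forall>T\<ge>1. \<forall>n\<le>T. (\<integral>\<^sup>+\<omega>. ennreal (\<bar>\<Sum>t=1..n.
     regressor_vec T T (X t \<omega>) (w (int t) \<omega>) $ k * u (int t) \<omega> $ j\<bar> ^ 4) \<partial>M) \<le> ennreal (B * (real T)\<^sup>2)"
proof -
  have iid: "iid_innovations M \<epsilon> e" and lin: "linear_process M C \<epsilon> u" and w: "w t \<in> borel_measurable M" for t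
    using A by (auto simp: assumption_A_def stationary_regressor_def)
  have u: "u t \<in> borel_measurable M" for t using lin by (simp add: linear_process_def)
  note [measurable] = borel_measurable_vec_nth[OF u] borel_measurable_vec_nth[OF w] borel_measurable_vec_nth[OF X]
  obtain \<kappa> where \<kappa>: "\<kappa> > 0"
    and SX: "\<And>l. (SUP T\<in>{1..}. SUP t\<in>{1..T}.
            \<integral>\<^sup>+\<omega>. ennreal (\<bar>1 / real T * (\<Sum>i=1..t. X i \<omega> $ l * u (int i) \<omega> $ j)\<bar> powr (4 + \<kappa>)) \<partial>M) < \<infinity>"
    and Sw: "\<And>l. (SUP T\<in>{1..}. SUP t\<in>{1..T}.
            \<integral>\<^sup>+\<omega>. ennreal (\<bar>1 / sqrt (real T) * (\<Sum>i=1..t. w (int i) \<omega> $ l * u (int i) \<omega> $ j)\<bar> powr (4 + \<kappa>)) \<partial>M) < \<infinity>"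
    using A unfolding assumption_A_def by blast
  \<comment> \<open>A finite iterated supremum of moments of order \<open>4 + \<kappa>\<close>
    yields one real bound on the fourth moments.\<close>
  have bnd: "\<exists>B\<ge>0. \<forall>T\<ge>1. \<forall>n\<in>{1..T}. (\<integral>\<^sup>+\<omega>. ennreal (\<bar>P T n \<omega>\<bar> ^ 4) \<partial>M) \<le> ennreal B"
    if [measurable]: "\<And>T n. P T n \<in> borel_measurable M" and 
      S: "(SUP T\<in>{1..}. SUP t\<in>{1..T}. \<integral>\<^sup>+\<omega>. ennreal (\<bar>P T t \<omega>\<bar> powr (4 + \<kappa>)) \<partial>M) < \<infinity>"
    for P :: "nat \<Rightarrow> nat \<Rightarrow> 'a \<Rightarrow> real"
  proof -
    obtain c where c: "0 \<le> c"
      "(SUP T\<in>{1..}. SUP t\<in>{1..T}. \<integral>\<^sup>+\<omega>. ennreal (\<bar>P T t \<omega>\<bar> powr (4 + \<kappa>)) \<partial>M) = ennreal c"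
      using S unfolding infinity_ennreal_def less_top_ennreal by blast
    have "(\<integral>\<^sup>+\<omega>. ennreal (\<bar>P T n \<omega>\<bar> powr (4 + \<kappa>)) \<partial>M) \<le> ennreal c" if "1 \<le> T" "n \<in> {1..T}" for T n
      unfolding c(2)[symmetric] using that by (intro SUP_upper2[of T] SUP_upper2[of n]) auto
    then show ?thesis
      using c(1) nn_integral_power4_le[OF _ \<kappa>, of "P _ _" c] by (intro exI[of _ "1 + c"]) auto
  qed
  let ?Q = "\<lambda>T n \<omega>. \<Sum>t=1..n. regressor_vec T T (X t \<omega>) (w (int t) \<omega>) $ k * u (int t) \<omega> $ j"
  have scaled: ?thesis
    if P: "\<And>T n. P T n \<in> borel_measurable M"
      and S: "(SUP T\<in>{1..}. SUP t\<in>{1..T}. \<integral>\<^sup>+\<omega>. ennreal (\<bar>P T t \<omega>\<bar> powr (4 + \<kappa>)) \<partial>M) < \<infinity>"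
      and Q: "\<And>T n \<omega>. 1 \<le> T \<Longrightarrow> ?Q T n \<omega> = sqrt (real T) * P T n \<omega>"
    for P :: "nat \<Rightarrow> nat \<Rightarrow> 'a \<Rightarrow> real"
  proof -
    obtain B where B: "B \<ge> 0" "\<And>T n. 1 \<le> T \<Longrightarrow> n \<in> {1..T} \<Longrightarrow> (\<integral>\<^sup>+\<omega>. ennreal (\<bar>P T n \<omega>\<bar> ^ 4) \<partial>M) \<le> ennreal B"
      using bnd[OF P S] by blast
    have "(\<integral>\<^sup>+\<omega>. ennreal (\<bar>?Q T n \<omega>\<bar> ^ 4) \<partial>M) \<le> ennreal (B * (real T)\<^sup>2)" if "1 \<le> T" "n \<le> T" for T n
    \<comment> \<open>The supremum starts at 1, so the empty sum is treated separately.\<close>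
    proof (cases "n = 0")
      case False
      then have "(\<integral>\<^sup>+\<omega>. ennreal (\<bar>?Q T n \<omega>\<bar> ^ 4) \<partial>M) \<le> ennreal (sqrt (real T) ^ 4 * B)"
        using that by (intro nn_integral_cmult_power4[OF P B(2) Q]) auto
      also have "sqrt (real T) ^ 4 = (real T)\<^sup>2"
        by (simp add: power4_eq_xxxx power2_eq_square)
      finally show ?thesis by (simp add: mult.commute)
    qed simp
    then show ?thesis using B(1) by blast
  qed
  consider (stoch) l where "k = Inl l" | (det) m where "k = Inr (Inl m)" | (stat) l where "k = Inr (Inr l)"
    by (metis sum.exhaust)
  then show ?thesis
  proof cases
    case stoch
    show ?thesis
    proof (rule scaled[OF _ SX[of l]])
      fix T n :: nat and \<omega> assume T: "1 \<le> T"
      \<comment> \<open>The scaling of the integrated regressor is rewritten to exhibit the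
        normalization \<open>1 / T\<close> of the assumption, leaving the factor
        \<open>sqrt T\<close>.\<close>
      have "real T powr (- 1 / 2) = 1 / sqrt (real T)"
        by (simp add: powr_minus_divide powr_half_sqrt)
      also have "\<dots> = sqrt (real T) * (1 / real T)"
        using T real_div_sqrt[of "real T"] by (simp add: divide_simps)
      finally show "?Q T n \<omega> = sqrt (real T) * (1 / real T * (\<Sum>i=1..n. X i \<omega> $ l * u (int i) \<omega> $ j))"
        by (simp add: stoch regressor_vec_def sum_distrib_left mult.assoc)
    qed simp
  next
    case stat
    show ?thesis
    proof (rule scaled[OF _ Sw[of l]])
      fix T n :: nat and \<omega> assume "1 \<le> T"
      then show "?Q T n \<omega> = sqrt (real T) * (1 / sqrt (real T) * (\<Sum>i=1..n. w (int i) \<omega> $ l * u (int i) \<omega> $ j))"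
        by (simp add: stat regressor_vec_def)
    qed simp
  next
    case det
    obtain B where B: "0 \<le> B"
      "\<And>n. (\<integral>\<^sup>+\<omega>. ennreal (norm (\<Sum>t=1..n. u (int t) \<omega>) ^ 4) \<partial>M) \<le> ennreal (B * (real n)\<^sup>2)"
      using linear_process_partial_sum_fourth_moment[OF iid lin] by blast
    have "(\<integral>\<^sup>+\<omega>. ennreal (\<bar>?Q T n \<omega>\<bar> ^ 4) \<partial>M) \<le> ennreal (B * (real T)\<^sup>2)" if "1 \<le> T" "n \<le> T" for T n
    proof -
      have "\<bar>?Q T n \<omega>\<bar> \<le> norm (\<Sum>t=1..n. u (int t) \<omega>)" for \<omega>
        using component_le_norm_cart[of "\<Sum>t=1..n. u (int t) \<omega>" j] that
        by (simp add: det regressor_vec_def sum_component)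
      then have "(\<integral>\<^sup>+\<omega>. ennreal (\<bar>?Q T n \<omega>\<bar> ^ 4) \<partial>M) \<le> (\<integral>\<^sup>+\<omega>. ennreal (norm (\<Sum>t=1..n. u (int t) \<omega>) ^ 4) \<partial>M)"
        by (intro nn_integral_mono ennreal_leI power_mono) auto
      also have "\<dots> \<le> ennreal (B * (real n)\<^sup>2)" by (rule B(2))
      also have "\<dots> \<le> ennreal (B * (real T)\<^sup>2)"
        using B(1) that by (intro ennreal_leI mult_left_mono power_mono) auto
      finally show ?thesis .
    qed
    then show ?thesis using B(1) by blast
  qed
qed

section \<open>Markov's inequality for fourth powers and the union bound\<close>

lemma (in prob_space) prob_gt_le_fourth_moment:
  fixes P :: "'a \<Rightarrow> real"
  assumes [measurable]: "P \<in> borel_measurable M"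
    and "(\<integral>\<^sup>+\<omega>. ennreal (\<bar>P \<omega>\<bar> ^ 4) \<partial>M) \<le> ennreal B" and "0 \<le> B" "0 < b"
  shows "prob {\<omega> \<in> space M. b < \<bar>P \<omega>\<bar>} \<le> B / b ^ 4"
proof -
  have int: "integrable M (\<lambda>\<omega>. \<bar>P \<omega>\<bar> ^ 4)"
    using assms(2) by (intro integrableI_bounded) (auto intro: le_less_trans)
  have "ennreal (expectation (\<lambda>\<omega>. \<bar>P \<omega>\<bar> ^ 4)) \<le> ennreal B"
    using assms(2) by (subst nn_integral_eq_integral[symmetric, OF int]) auto
  then have le: "expectation (\<lambda>\<omega>. \<bar>P \<omega>\<bar> ^ 4) \<le> B" using assms(3) by (simp add: ennreal_le_iff)
  have "prob {\<omega> \<in> space M. b < \<bar>P \<omega>\<bar>} \<le> prob {\<omega> \<in> space M. b ^ 4 \<le> \<bar>P \<omega>\<bar> ^ 4}"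
    using assms(4) by (intro finite_measure_mono) (auto intro!: power_mono simp del: power_even_abs power_even_abs_numeral)
  also have "\<dots> \<le> expectation (\<lambda>\<omega>. \<bar>P \<omega>\<bar> ^ 4) / b ^ 4"
    using assms(4) by (intro integral_Markov_inequality_measure[where A = "space M"] int) auto
  also have "\<dots> \<le> B / b ^ 4" using le assms(4) by (intro divide_right_mono) auto
  finally show ?thesis .
qed

lemma (in prob_space) prob_Union_gt_le_fourth_moment:
  fixes P :: "'i \<Rightarrow> 'a \<Rightarrow> real"
  assumes "finite I" and [measurable]: "\<And>i. i \<in> I \<Longrightarrow> P i \<in> borel_measurable M"
    and "\<And>i. i \<in> I \<Longrightarrow> (\<integral>\<^sup>+\<omega>. ennreal (\<bar>P i \<omega>\<bar> ^ 4) \<partial>M) \<le> ennreal B" and "0 \<le> B" "0 < b"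
  shows "prob {\<omega> \<in> space M. \<exists>i\<in>I. b < \<bar>P i \<omega>\<bar>} \<le> real (card I) * (B / b ^ 4)"
proof -
  have eq: "{\<omega> \<in> space M. \<exists>i\<in>I. b < \<bar>P i \<omega>\<bar>} = (\<Union>i\<in>I. {\<omega> \<in> space M. b < \<bar>P i \<omega>\<bar>})" by auto
  have "prob (\<Union>i\<in>I. {\<omega> \<in> space M. b < \<bar>P i \<omega>\<bar>}) \<le> (\<Sum>i\<in>I. prob {\<omega> \<in> space M. b < \<bar>P i \<omega>\<bar>})"
    using assms(1) by (intro finite_measure_subadditive_finite) (auto intro!: measurable)
  also have "\<dots> \<le> real (card I) * (B / b ^ 4)"
    using assms by (intro sum_bounded_above prob_gt_le_fourth_moment) auto
  finally show ?thesis unfolding eq .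
qed

section \<open>Choice of the level and the probability bound\<close>

theorem theorem1:
  fixes M :: "'a measure"
    and C :: "nat \<Rightarrow> real ^ 'm::finite ^ 'q::finite" and D :: "nat \<Rightarrow> real ^ 'n::finite ^ 'r::finite"
    and \<epsilon> :: "int \<Rightarrow> 'a \<Rightarrow> real ^ 'm" and e :: "int \<Rightarrow> 'a \<Rightarrow> real ^ 'n"
    and u :: "int \<Rightarrow> 'a \<Rightarrow> real ^ 'q" and \<xi> :: "int \<Rightarrow> 'a \<Rightarrow> real ^ 'r"
    and X :: "nat \<Rightarrow> 'a \<Rightarrow> real ^ 'r" and w :: "int \<Rightarrow> 'a \<Rightarrow> real ^ 's::finite"
    and Y :: "nat \<Rightarrow> nat \<Rightarrow> 'a \<Rightarrow> real ^ 'q"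
    and \<theta>0 :: "nat \<Rightarrow> nat \<Rightarrow> ('q, 'r, 's) coeff"
    and \<theta>hat :: "nat \<Rightarrow> nat \<Rightarrow> 'a \<Rightarrow> ('q, 'r, 's) coeff"
    and bp :: "nat \<Rightarrow> nat \<Rightarrow> nat" and lam :: "nat \<Rightarrow> real"
    and m0 d :: nat and c0 :: real
  assumes "prob_space M"
    and d: "d = CARD('q) * (CARD('r) + 2 + CARD('s))"
    and X_meas: "\<And>t. X t \<in> borel_measurable M"
    and X_rec: "\<And>t \<omega>. t \<ge> 1 \<Longrightarrow> \<omega> \<in> space M \<Longrightarrow> X t \<omega> = X (t - 1) \<omega> + \<xi> (int t) \<omega>"
    and breaks: "\<And>T. m0 < T \<Longrightarrow> has_breaks T m0 (bp T) (\<theta>0 T)"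
    and model: "\<And>T t \<omega>. m0 < T \<Longrightarrow> t \<in> {1..T} \<Longrightarrow> \<omega> \<in> space M \<Longrightarrow>
        Y T t \<omega> = Zbar T t (X t \<omega>) (w (int t) \<omega>) *v
                     (\<Sum>i=1..t. transpose commutation_matrix *v \<theta>0 T i) + u (int t) \<omega>"
    and A: "assumption_A M C D \<epsilon> e u \<xi> X w"
    and C: "assumption_C m0 bp \<theta>0 lam"
    and c0: "c0 > 0"
    and lam: "\<And>T. 2 \<le> T \<Longrightarrow> lam T = 2 * real d * c0 * (ln (real T) / real T) powr (1 / 4)"
    and \<theta>hat_meas: "\<And>T i. \<theta>hat T i \<in> borel_measurable M"
    and \<theta>hat: "\<And>T \<omega>. 2 \<le> T \<Longrightarrow> m0 < T \<Longrightarrow> \<omega> \<in> space M \<Longrightarrow>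
        is_group_lasso T (lam T) (\<lambda>t. X t \<omega>) (\<lambda>t. w (int t) \<omega>) (\<lambda>t. Y T t \<omega>) (\<lambda>i. \<theta>hat T i \<omega>)"
  shows "\<exists>K>0. \<forall>T. 2 \<le> T \<longrightarrow> m0 < T \<longrightarrow>
    measure M {\<omega> \<in> space M.
        1 / real T * (stacked_norm T
            (design_apply T (\<lambda>t. X t \<omega>) (\<lambda>t. w (int t) \<omega>) (\<lambda>i. \<theta>hat T i \<omega> - \<theta>0 T i)))\<^sup>2
        \<le> 4 * real d * c0 * (ln (real T) / real T) powr (1 / 4) * real (m0 + 1)
             * max_magnitude m0 (bp T) (\<theta>0 T)}
      > 1 - K / (c0 ^ 4 * ln (real T))"
proof -
  interpret prob_space M by fact
  have w: "w t \<in> borel_measurable M" and u: "u t \<in> borel_measurable M" for t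
    using A by (auto simp: assumption_A_def stationary_regressor_def linear_process_def)
  \<comment> \<open>The index is a triple of regressor coordinate, equation and length, so that a
    single union bound covers all partial sums.\<close>
  define Q where "Q T = (\<lambda>(k, j, n) \<omega>.
      \<Sum>t=1..n. regressor_vec T T (X t \<omega>) (w (int t) \<omega>) $ k * u (int t) \<omega> $ j)" for T
  have Qm: "Q T p \<in> borel_measurable M" for T p
    unfolding Q_def split_beta
    by (intro borel_measurable_sum borel_measurable_times borel_measurable_regressor_vec
        borel_measurable_vec_nth X_meas w u)
  have "\<forall>k j. \<exists>B. 0 \<le> B \<and> (\<forall>T n. 1 \<le> T \<longrightarrow> n \<le> T \<longrightarrow>
      (\<integral>\<^sup>+\<omega>. ennreal (\<bar>Q T (k, j, n) \<omega>\<bar> ^ 4) \<partial>M) \<le> ennreal (B * (real T)\<^sup>2))"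
  proof (intro allI)
    fix k j
    obtain B where "B \<ge> 0" "\<forall>T\<ge>1. \<forall>n\<le>T. (\<integral>\<^sup>+\<omega>. ennreal (\<bar>Q T (k, j, n) \<omega>\<bar> ^ 4) \<partial>M) \<le> ennreal (B * (real T)\<^sup>2)"
      using score_fourth_moment[OF A X_meas, of k j] unfolding Q_def case_prod_conv by auto
    then show "\<exists>B. 0 \<le> B \<and> (\<forall>T n. 1 \<le> T \<longrightarrow> n \<le> T \<longrightarrow>
      (\<integral>\<^sup>+\<omega>. ennreal (\<bar>Q T (k, j, n) \<omega>\<bar> ^ 4) \<partial>M) \<le> ennreal (B * (real T)\<^sup>2))"
      by blast
  qed
  then obtain Bs where Bs: "\<And>k j. 0 \<le> Bs k j" "\<And>k j T n. 1 \<le> T \<Longrightarrow> n \<le> T \<Longrightarrow>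
      (\<integral>\<^sup>+\<omega>. ennreal (\<bar>Q T (k, j, n) \<omega>\<bar> ^ 4) \<partial>M) \<le> ennreal (Bs k j * (real T)\<^sup>2)"
    unfolding choice_iff by blast
  \<comment> \<open>The sum over the finitely many coordinates dominates each \<open>Bs k j\<close>
    and depends neither on \<open>T\<close> nor on \<open>c0\<close>.\<close>
  define B where "B = (\<Sum>k\<in>UNIV. \<Sum>j\<in>UNIV. Bs k j)"
  have B: "0 \<le> B" unfolding B_def by (intro sum_nonneg Bs)
  have BsB: "Bs k j \<le> B" for k j
  proof -
    have "Bs k j \<le> (\<Sum>j\<in>UNIV. Bs k j)" by (rule member_le_sum) (auto simp: Bs)
    also have "\<dots> \<le> B" unfolding B_def by (rule member_le_sum) (auto simp: Bs sum_nonneg)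
    finally show ?thesis .
  qed
  have "measure M {\<omega> \<in> space M.
        1 / real T * (stacked_norm T
            (design_apply T (\<lambda>t. X t \<omega>) (\<lambda>t. w (int t) \<omega>) (\<lambda>i. \<theta>hat T i \<omega> - \<theta>0 T i)))\<^sup>2
        \<le> 4 * real d * c0 * (ln (real T) / real T) powr (1 / 4) * real (m0 + 1)
             * max_magnitude m0 (bp T) (\<theta>0 T)}
      > 1 - (16 * real d * B + 1) / (c0 ^ 4 * ln (real T))" (is "prob ?G > _")
    if T: "2 \<le> T" "m0 < T" for T
  proof -
    let ?I = "(UNIV :: ('r, 's) regressor set) \<times> (UNIV :: 'q set) \<times> {1..T}"
    define \<rho> where "\<rho> = (ln (real T) / real T) powr (1 / 4)"
    \<comment> \<open>Partial sums below \<open>b\<close> give tails below \<open>2 * b\<close>, and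
      for this level the condition on the penalty, \<open>2 * d * (2 * b) \<le> lam T * T\<close>,
      holds with equality.\<close>
    define b where "b = real T * c0 * \<rho> / 2"
    let ?bad = "{\<omega> \<in> space M. \<exists>p\<in>?I. b < \<bar>Q T p \<omega>\<bar>}"
    have ln: "0 < ln (real T)" using T by simp
    then have \<rho>: "0 < \<rho>" "\<rho> ^ 4 = ln (real T) / real T"
      using T by (auto simp: \<rho>_def powr_power)
    have b: "0 < b" using \<rho> c0 T by (simp add: b_def)
    have lamT: "lam T = 2 * real d * c0 * \<rho>" using lam[OF T(1)] by (simp add: \<rho>_def)
    have "prob ?bad \<le> real (card ?I) * (B * (real T)\<^sup>2 / b ^ 4)"
    proof (rule prob_Union_gt_le_fourth_moment)
      fix p assume "p \<in> ?I"
      then obtain k j n where p: "p = (k, j, n)" "n \<le> T" by auto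
      have "(\<integral>\<^sup>+\<omega>. ennreal (\<bar>Q T p \<omega>\<bar> ^ 4) \<partial>M) \<le> ennreal (Bs k j * (real T)\<^sup>2)"
        using Bs(2) p T by simp
      also have "\<dots> \<le> ennreal (B * (real T)\<^sup>2)"
        using BsB by (intro ennreal_leI mult_right_mono) auto
      finally show "(\<integral>\<^sup>+\<omega>. ennreal (\<bar>Q T p \<omega>\<bar> ^ 4) \<partial>M) \<le> ennreal (B * (real T)\<^sup>2)" .
    qed (use Qm B b in auto)
    also have "card ?I = d * T"
      by (simp add: card_cartesian_product d algebra_simps)
    \<comment> \<open>Here \<open>b ^ 4\<close> equals \<open>c0 ^ 4 * T ^ 3 * ln T / 16\<close>.
      Its factor \<open>T ^ 3\<close> cancels against the \<open>d * T\<close> events times the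
      moment bound \<open>B * T^2\<close>, and \<open>1 / ln T\<close> remains.\<close>
    also have "real (d * T) * (B * (real T)\<^sup>2 / b ^ 4) = 16 * real d * B / (c0 ^ 4 * ln (real T))"
      using T c0 ln unfolding b_def power_divide power_mult_distrib \<rho>(2)
      by (simp add: field_simps power4_eq_xxxx power2_eq_square)
    \<comment> \<open>The added 1 makes the inequality strict and keeps the constant positive when
      \<open>B = 0\<close>.\<close>
    also have "\<dots> < (16 * real d * B + 1) / (c0 ^ 4 * ln (real T))"
      using c0 ln by (intro divide_strict_right_mono) auto
    finally have bad: "prob ?bad < (16 * real d * B + 1) / (c0 ^ 4 * ln (real T))" .
    have bad_sets: "?bad \<in> events"
    proof -
      note [measurable] = Qm
      have "?bad = (\<Union>p\<in>?I. {\<omega> \<in> space M. b < \<bar>Q T p \<omega>\<bar>})" by auto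
      also have "\<dots> \<in> events" by (intro sets.finite_UN) auto
      finally show ?thesis .
    qed
    \<comment> \<open>Monotonicity of the probability requires the larger set to be an event; this
      is where measurability of the estimator enters.\<close>
    have G_sets: "?G \<in> events"
    proof -
      have [measurable]: "(\<lambda>\<omega>. design_apply T (\<lambda>t. X t \<omega>) (\<lambda>t. w (int t) \<omega>) (\<lambda>i. \<theta>hat T i \<omega> - \<theta>0 T i) t)
          \<in> borel_measurable M" for t
        by (intro borel_measurable_design_apply X_meas w borel_measurable_diff \<theta>hat_meas borel_measurable_const)
      show ?thesis unfolding stacked_norm_squared by measurable
    qed
    \<comment> \<open>Outside the bad event the argument is deterministic, one outcome at a
      time.\<close>
    have "space M - ?bad \<subseteq> ?G"
    proof
      fix \<omega> assume \<omega>: "\<omega> \<in> space M - ?bad"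
      then have in_space: "\<omega> \<in> space M" and good: "\<forall>p\<in>?I. \<bar>Q T p \<omega>\<bar> \<le> b"
        by (simp_all add: not_less del: mem_Times_iff)
      have small: "\<bar>\<Sum>t=1..n. regressor_vec T T (X t \<omega>) (w (int t) \<omega>) $ k * u (int t) \<omega> $ j\<bar> \<le> b"
        if "n \<le> T" for n k j
      proof (cases "n = 0")
        case False
        then have "(k, j, n) \<in> ?I" using that by simp
        then have "\<bar>Q T (k, j, n) \<omega>\<bar> \<le> b" by (rule bspec[OF good])
        then show ?thesis by (simp add: Q_def)
      qed (use b in simp)
      have "1 / real T * (stacked_norm T
            (design_apply T (\<lambda>t. X t \<omega>) (\<lambda>t. w (int t) \<omega>) (\<lambda>i. \<theta>hat T i \<omega> - \<theta>0 T i)))\<^sup>2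
        \<le> 2 * lam T * (\<Sum>i=1..T. norm (\<theta>0 T i))"
      proof (rule group_lasso_prediction_error_le[OF _ _ \<theta>hat[OF T in_space]])
        show "\<bar>\<Sum>t=i..T. regressor_vec T t (X t \<omega>) (w (int t) \<omega>) $ k * u (int t) \<omega> $ j\<bar> \<le> 2 * b"
          if "i \<in> {1..T}" for i k j
          using that by (intro regressor_tail_sum_le small) auto
        show "Y T t \<omega> = design_apply T (\<lambda>t. X t \<omega>) (\<lambda>t. w (int t) \<omega>) (\<theta>0 T) t + u (int t) \<omega>"
          if "t \<in> {1..T}" for t
          using model[OF T(2) that in_space] by (simp add: design_apply_def)
        show "2 * real (CARD('q) * (CARD('r) + 2 + CARD('s))) * (2 * b) \<le> lam T * real T"
          unfolding d[symmetric] lamT b_def by simp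
      qed (use T lamT c0 \<rho> in auto)
      also have "\<dots> \<le> 2 * lam T * (real (m0 + 1) * max_magnitude m0 (bp T) (\<theta>0 T))"
        using lamT c0 \<rho> by (intro mult_left_mono sum_norm_le_max_magnitude breaks T) auto
      \<comment> \<open>The constant \<open>4 * d * c0\<close> of the bound is that of
        \<open>2 * lam T\<close>.\<close>
      finally show "\<omega> \<in> ?G" using in_space by (simp add: lamT \<rho>_def mult.assoc)
    qed
    then have "prob (space M - ?bad) \<le> prob ?G"
      using G_sets by (rule finite_measure_mono)
    then show ?thesis using bad prob_compl[OF bad_sets] by linarith
  qed
  moreover have "0 < 16 * real d * B + 1" using B by (simp add: add_nonneg_pos)
  ultimately show ?thesis by blast
qed

end
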